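(* Let $n>1$ be an integer and $w\in\mathcal{S}_n$. (1) The pair $(w',w)$ is good for every $w'\in\mathcal{S}_n$ with $w'\preceq w$ if and only if $w$ avoids the four patterns $[4231]$, $[42513]$, $[35142]$ and $[351624]$. (2) The pair $(w,w'')$ is good for every $w''\in\mathcal{S}_n$ with $w\preceq w''$ if and only if $w$ avoids the four patterns $[1324]$, $[24153]$, $[31524]$ and $[426153]$.
   Context: $\mathcal{S}_n$ is the symmetric group, viewed as the Weyl group of the root system $\Phi=\{e_i-e_j: 1\le i\ne j\le n\}\subset\mathbb{Q}^n$, acting by $w(e_i)=e_{w(i)}$, with simple roots $e_i-e_{i+1}$; $\preceq$ is the associated Bruhat order. Permutations are written $[w(1)\ldots w(n)]$. For a root $\alpha=e_i-e_j$, $s_\alpha$ is the transposition $(i,j)$. For $w\in\mathcal{S}_n$, $\Phi_w=\Phi\cap\operatorname{im}(w-\mathrm{id})$. For $w_1\preceq w_2$, $(w_1,w_2)$ is a good pair if there is a (possibly empty) sequence $(\alpha_1,\dots,\alpha_r)$ of roots in $\Phi_{w_1w_2^{-1}}$ such that $w_2=s_{\alpha_r}\cdots s_{\alpha_1}w_1$ and $s_{\alpha_i}\cdots s_{\alpha_1}w_1\succ s_{\alpha_{i-1}}\cdots s_{\alpha_1}w_1$ for each $1\le i\le r$; otherwise it is a bad pair. $w\in\mathcal{S}_n$ has the pattern $f\in\mathcal{S}_m$ if there exist $1\le i_1<\dots<i_m\le n$ such that for all $1\le k<l\le m$, $w(i_k)<w(i_l)$ if and only if $f(k)<f(l)$;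 $w$ avoids $f$ if it does not have the pattern $f$. *)

theory Defs
  imports Complex_Main "HOL-Combinatorics.Permutations"
begin

section \<open>The symmetric group as a Weyl group\<close>

text \<open>
  An element of the symmetric group on \<open>{1..n}\<close> is a function \<open>w :: nat \<Rightarrow> nat\<close> with
  \<open>w permutes {1..n}\<close>, and the product of the group is composition of functions.
  A vector of rational \<open>n\<close>-space is a function on \<open>nat\<close> vanishing outside \<open>{1..n}\<close>.
\<close>

definition rat_space :: "nat \<Rightarrow> (nat \<Rightarrow> rat) set" where
  "rat_space n = {v. \<forall>k. k \<notin> {1..n} \<longrightarrow> v k = 0}"

definition unit_vector :: "nat \<Rightarrow> nat \<Rightarrow> rat" where
  "unit_vector i = (\<lambda>k. if k = i then 1 else 0)"

text \<open>The linear action with \<open>w (e\<^sub>i) = e\<^bsub>w(i)\<^esub>\<close>, see \<open>perm_action_unit_vector\<close> below.\<close>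

definition perm_action :: "(nat \<Rightarrow> nat) \<Rightarrow> (nat \<Rightarrow> rat) \<Rightarrow> nat \<Rightarrow> rat" where
  "perm_action w v = (\<lambda>k. v (inv w k))"

lemma perm_action_unit_vector:
  assumes "w permutes {1..n}"
  shows "perm_action w (unit_vector i) = unit_vector (w i)"
  using permutes_inverses[OF assms]
  by (auto simp: perm_action_def unit_vector_def fun_eq_iff)

definition roots :: "nat \<Rightarrow> (nat \<Rightarrow> rat) set" where
  "roots n = {unit_vector i - unit_vector j | i j. i \<in> {1..n} \<and> j \<in> {1..n} \<and> i \<noteq> j}"

definition simple_roots :: "nat \<Rightarrow> (nat \<Rightarrow> rat) set" where
  "simple_roots n = {unit_vector i - unit_vector (i + 1) | i. 1 \<le> i \<and> i < n}"

text \<open>For \<open>\<alpha> = e\<^sub>i - e\<^sub>j\<close> the indices \<open>i\<close> and \<open>j\<close> are recovered from the coordinates of \<open>\<alpha>\<close>.\<close>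

definition reflection :: "(nat \<Rightarrow> rat) \<Rightarrow> nat \<Rightarrow> nat" where
  "reflection \<alpha> = Transposition.transpose (THE i. \<alpha> i = 1) (THE j. \<alpha> j = -1)"

lemma reflection_root:
  assumes "i \<noteq> j"
  shows "reflection (unit_vector i - unit_vector j) = Transposition.transpose i j"
proof -
  have "(THE k. (unit_vector i - unit_vector j) k = 1) = i"
    using assms by (intro the_equality) (auto simp: unit_vector_def split: if_splits)
  moreover have "(THE k. (unit_vector i - unit_vector j) k = -1) = j"
    using assms by (intro the_equality) (auto simp: unit_vector_def split: if_splits)
  ultimately show ?thesis
    by (simp add: reflection_def)
qed

definition root_subset :: "nat \<Rightarrow> (nat \<Rightarrow> nat) \<Rightarrow> (nat \<Rightarrow> rat) set" where
  "root_subset n w = roots n \<inter> (\<lambda>v. perm_action w v - v) ` rat_space n"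

text \<open>
  \<open>apply_reflections [\<alpha>\<^sub>1, \<dots>, \<alpha>\<^sub>r] w\<close> is
  \<open>reflection \<alpha>\<^sub>r \<circ> \<dots> \<circ> reflection \<alpha>\<^sub>1 \<circ> w\<close>.
\<close>

definition apply_reflections :: "(nat \<Rightarrow> rat) list \<Rightarrow> (nat \<Rightarrow> nat) \<Rightarrow> nat \<Rightarrow> nat" where
  "apply_reflections \<alpha>s w = fold (\<lambda>\<alpha> u. reflection \<alpha> \<circ> u) \<alpha>s w"


section \<open>Bruhat order and good pairs\<close>

definition coxeter_length :: "nat \<Rightarrow> (nat \<Rightarrow> nat) \<Rightarrow> nat" where
  "coxeter_length n w =
    (LEAST k. \<exists>\<alpha>s. length \<alpha>s = k \<and> set \<alpha>s \<subseteq> simple_roots n \<and> w = apply_reflections \<alpha>s id)"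

definition bruhat_step :: "nat \<Rightarrow> (nat \<Rightarrow> nat) \<Rightarrow> (nat \<Rightarrow> nat) \<Rightarrow> bool" where
  "bruhat_step n u v \<longleftrightarrow>
    (\<exists>\<alpha>\<in>roots n. v = reflection \<alpha> \<circ> u \<and> coxeter_length n u < coxeter_length n v)"

definition bruhat_le :: "nat \<Rightarrow> (nat \<Rightarrow> nat) \<Rightarrow> (nat \<Rightarrow> nat) \<Rightarrow> bool" where
  "bruhat_le n u v \<longleftrightarrow> u permutes {1..n} \<and> v permutes {1..n} \<and> (bruhat_step n)\<^sup>*\<^sup>* u v"

definition bruhat_less :: "nat \<Rightarrow> (nat \<Rightarrow> nat) \<Rightarrow> (nat \<Rightarrow> nat) \<Rightarrow> bool" where
  "bruhat_less n u v \<longleftrightarrow> bruhat_le n u v \<and> u \<noteq> v"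

definition good_pair :: "nat \<Rightarrow> (nat \<Rightarrow> nat) \<Rightarrow> (nat \<Rightarrow> nat) \<Rightarrow> bool" where
  "good_pair n w1 w2 \<longleftrightarrow> bruhat_le n w1 w2 \<and>
    (\<exists>\<alpha>s. set \<alpha>s \<subseteq> root_subset n (w1 \<circ> inv w2) \<and>
      w2 = apply_reflections \<alpha>s w1 \<and>
      (\<forall>i\<in>{1..length \<alpha>s}.
        bruhat_less n (apply_reflections (take (i - 1) \<alpha>s) w1) (apply_reflections (take i \<alpha>s) w1)))"


section \<open>Patterns\<close>

text \<open>The permutation with one-line notation \<open>xs\<close>; positions are counted from 1.\<close>

definition one_line :: "nat list \<Rightarrow> nat \<Rightarrow> nat" where
  "one_line xs k = (if k \<in> {1..length xs} then xs ! (k - 1) else k)"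

lemma one_line_permutes:
  assumes "set xs = {1..length xs}"
  shows "one_line xs permutes {1..length xs}"
proof -
  have "one_line xs ` {1..length xs} = set xs"
  proof -
    have "{1..length xs} = Suc ` {..<length xs}"
      by (simp add: image_Suc_lessThan)
    then show ?thesis
      by (auto simp: one_line_def image_image set_conv_nth)
  qed
  then have "bij_betw (one_line xs) {1..length xs} {1..length xs}"
    using assms by (simp add: bij_betw_def eq_card_imp_inj_on)
  then show ?thesis
    by (rule bij_imp_permutes) (simp add: one_line_def del: atLeastAtMost_iff)
qed

definition has_pattern :: "nat \<Rightarrow> (nat \<Rightarrow> nat) \<Rightarrow> nat \<Rightarrow> (nat \<Rightarrow> nat) \<Rightarrow> bool" where
  "has_pattern n w m f \<longleftrightarrow>
    (\<exists>i. strict_mono_on {1..m} i \<and> i ` {1..m} \<subseteq> {1..n} \<and>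
      (\<forall>k\<in>{1..m}. \<forall>l\<in>{1..m}. k < l \<longrightarrow> (w (i k) < w (i l) \<longleftrightarrow> f k < f l)))"

definition avoids :: "nat \<Rightarrow> (nat \<Rightarrow> nat) \<Rightarrow> nat list \<Rightarrow> bool" where
  "avoids n w xs \<longleftrightarrow> \<not> has_pattern n w (length xs) (one_line xs)"

end

(*
  A swap of two positions that raises the Bruhat order also raises (weakly) the rank function
  rank C u p v = #{j in C. j < p, v <= u j} of every block C of positions containing both or neither
  of them, and a reflection in a root of im (g - 1) preserves every g-stable set of values. Hence
  (u, w) is good iff u <= w and rank C u <= rank C w for all blocks C with u`C = w`C.

  If u <= w and this fails for a block C, move the point (p, v) of the violation to an essential box
  of w restricted to C. The values of u beyond that box in the two relevant corners are bounded by
  values of w (u lies in the hull of w), which yields one of the four patterns. Conversely each of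
  the four patterns gives an explicit bad pair below w. Part (2) follows from part (1) by reversing
  positions, which reverses the Bruhat order and preserves good pairs.
*)

theory Submission
  imports Defs
begin

section \<open>Length and inversions\<close>

text \<open>The image of g - 1, for g = \<open>u \<circ> inv w\<close>, consists of the vectors
  whose coordinates sum to zero on every cycle of g. Its roots therefore join indices of a common
  cycle, their reflections generate the full symmetric group on each cycle, and being good means
  that the rank criterion for the Bruhat order (Ehresmann's tableau criterion) holds on each cycle
  separately, whereas u \<le> w gives it on \<open>{1..n}\<close> only. In a bad pair the domination
  on all positions hides a violation on a block. The two scales meet in the pattern proof. The
  corner of a violation supplies points of w in \<open>C\<close> on its lower left and upper right
  side, up to two on each; the hull supplies an upper left and a lower right point, possibly outside
  \<open>C\<close>. On either side one point may fit between these two, or else both points of that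
  side are used. The 2 x 2 cases have 4, 5, 5 and 6 points: 4231, 42513, 35142, 351624.\<close>

definition inversions :: "nat \<Rightarrow> (nat \<Rightarrow> nat) \<Rightarrow> (nat \<times> nat) set" where
  "inversions n w = {(a, b). 1 \<le> a \<and> a < b \<and> b \<le> n \<and> w b < w a}"

lemma finite_inversions [simp]: "finite (inversions n w)"
  by (rule finite_subset[of _ "{1..n} \<times> {1..n}"]) (auto simp: inversions_def)

text \<open>\<open>f\<close> carries an inversion along the swap of positions, unless that would
  reverse the order of the pair. Such a pair stays where it is and remains an inversion because
  \<open>w p < w q\<close>. The new inversion \<open>(p, q)\<close> lies outside the image of
  \<open>f\<close>, whence strictness.\<close>

lemma card_inversions_swap:
  assumes "1 \<le> p" "p < q" "q \<le> n" "w p < w q"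
  shows "card (inversions n w) < card (inversions n (w \<circ> Transposition.transpose p q))"
proof -
  let ?t = "Transposition.transpose p q"
  define f where "f = (\<lambda>(a, b). if ?t a < ?t b then (?t a, ?t b) else (a, b))"
  have inj: "inj_on f (inversions n w)"
  proof (rule inj_onI)
    fix x y assume "x \<in> inversions n w" "y \<in> inversions n w" "f x = f y"
    then show "x = y"
      unfolding f_def inversions_def
      by (cases x; cases y)
        (auto split: if_splits dest: arg_cong[of _ _ ?t])
  qed
  have sub: "f ` inversions n w \<subseteq> inversions n (w \<circ> ?t)"
    using assms unfolding f_def inversions_def
    by (auto simp: transpose_def split: if_splits)
  have "(p, q) \<in> inversions n (w \<circ> ?t)"
    using assms by (simp add: inversions_def)
  moreover have "(p, q) \<notin> f ` inversions n w"
    using assms unfolding f_def inversions_def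
    by (auto simp: transpose_def split: if_splits)
  ultimately have "f ` inversions n w \<subset> inversions n (w \<circ> ?t)"
    using sub by blast
  then have "card (f ` inversions n w) < card (inversions n (w \<circ> ?t))"
    by (rule psubset_card_mono[rotated]) simp
  then show ?thesis
    using inj by (simp add: card_image)
qed

lemma swap_values_eq_swap_positions:
  assumes "inj u"
  shows "Transposition.transpose (u p) (u q) \<circ> u = u \<circ> Transposition.transpose p q"
  using assms by (auto simp: fun_eq_iff transpose_def dest: injD)

lemma card_inversions_swap_iff:
  assumes "w permutes {1..n}" "1 \<le> p" "p < q" "q \<le> n"
  shows "card (inversions n w) < card (inversions n (w \<circ> Transposition.transpose p q)) \<longleftrightarrow> w p < w q"
proof
  assume less: "card (inversions n w) < card (inversions n (w \<circ> Transposition.transpose p q))"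
  show "w p < w q"
  proof (rule ccontr)
    assume "\<not> w p < w q"
    moreover have "w p \<noteq> w q"
      using assms permutes_inj[OF assms(1)] by (auto dest: injD)
    ultimately have "card (inversions n (w \<circ> Transposition.transpose p q)) < card (inversions n (w \<circ> Transposition.transpose p q \<circ> Transposition.transpose p q))"
      using assms by (intro card_inversions_swap) auto
    then show False
      using less by (simp add: comp_assoc)
  qed
qed (use assms card_inversions_swap in blast)

text \<open>Exchanging two adjacent values affects a single comparison, the one between the
  positions that carry \<open>i\<close> and \<open>Suc i\<close>.\<close>

lemma card_inversions_simple_reflection:
  assumes "w permutes {1..n}"
  shows "card (inversions n (Transposition.transpose i (Suc i) \<circ> w)) \<le> Suc (card (inversions n w))"
proof -
  have inj: "inj w"
    using assms by (rule permutes_inj)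
  have "inversions n (Transposition.transpose i (Suc i) \<circ> w)
      \<subseteq> insert (inv w i, inv w (Suc i)) (inversions n w)"
    using inv_f_f[OF inj] by (auto simp: inversions_def transpose_def split: if_splits) metis
  then have "card (inversions n (Transposition.transpose i (Suc i) \<circ> w))
      \<le> card (insert (inv w i, inv w (Suc i)) (inversions n w))"
    by (intro card_mono) simp_all
  also have "\<dots> \<le> Suc (card (inversions n w))"
    by (simp add: card_insert_if)
  finally show ?thesis .
qed

lemma reflection_simple_root:
  assumes "\<alpha> \<in> simple_roots n"
  obtains i where "1 \<le> i" "i < n" "reflection \<alpha> = Transposition.transpose i (Suc i)"
  using assms reflection_root by (fastforce simp: simple_roots_def)

lemma apply_reflections_snoc [simp]:
  "apply_reflections (\<alpha>s @ [\<alpha>]) w = reflection \<alpha> \<circ> apply_reflections \<alpha>s w"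
  by (simp add: apply_reflections_def)

lemma apply_simple_reflections:
  assumes "set \<alpha>s \<subseteq> simple_roots n"
  shows "apply_reflections \<alpha>s id permutes {1..n} \<and>
    card (inversions n (apply_reflections \<alpha>s id)) \<le> length \<alpha>s"
  using assms
proof (induction \<alpha>s rule: rev_induct)
  case Nil
  have "inversions n id = {}"
    by (auto simp: inversions_def)
  then show ?case
    using permutes_id by (simp add: apply_reflections_def id_def)
next
  case (snoc \<alpha> \<alpha>s)
  then obtain i where i: "1 \<le> i" "i < n" "reflection \<alpha> = Transposition.transpose i (Suc i)"
    using reflection_simple_root by auto
  have "Transposition.transpose i (Suc i) permutes {1..n}"
    using i by (intro permutes_swap_id) auto
  moreover have u: "apply_reflections \<alpha>s id permutes {1..n}"
    "card (inversions n (apply_reflections \<alpha>s id)) \<le> length \<alpha>s"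
    using snoc.IH snoc.prems unfolding set_append by blast+
  moreover have "card (inversions n (Transposition.transpose i (Suc i) \<circ> apply_reflections \<alpha>s id))
      \<le> Suc (length \<alpha>s)"
    using card_inversions_simple_reflection[OF u(1), of i] u(2) by linarith
  ultimately show ?case
    unfolding apply_reflections_snoc i(3) length_append_singleton by (blast intro: permutes_compose)
qed

lemma permutes_without_descent:
  assumes "w permutes {1..n}" "\<And>i. 1 \<le> i \<Longrightarrow> i < n \<Longrightarrow> w i < w (Suc i)"
  shows "w = id"
proof -
  have "i \<le> w i" if "i \<in> {1..n}" for i
    using that
  proof (induction i)
    case (Suc i)
    show ?case
    proof (cases "i = 0")
      case True
      then show ?thesis
        using Suc.prems permutes_in_image[OF assms(1), of "Suc i"] by simp
    next
      case False
      then show ?thesis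
        using Suc assms(2)[of i] by simp
    qed
  qed simp
  then show ?thesis
    using permutes_natset_ge[OF assms(1)] by blast
qed

text \<open>Words multiply on the left, that is, they exchange values, so the descent is taken in
  \<open>inv w\<close>: \<open>Suc i\<close> stands to the left of \<open>i\<close>. Exchanging the
  two removes at least one inversion by \<open>card_inversions_swap\<close> and at most one by
  \<open>card_inversions_simple_reflection\<close>.\<close>

lemma reduced_word_exists:
  assumes "w permutes {1..n}"
  shows "\<exists>\<alpha>s. length \<alpha>s = card (inversions n w) \<and> set \<alpha>s \<subseteq> simple_roots n \<and>
    w = apply_reflections \<alpha>s id"
  using assms
proof (induction "card (inversions n w)" arbitrary: w rule: less_induct)
  case less
  show ?case
  proof (cases "inv w = id")
    case True
    then have "w = id"
      using less.prems by (metis inv_id permutes_inv_inv)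
    moreover have "inversions n id = {}"
      by (auto simp: inversions_def)
    ultimately show ?thesis
      by (auto intro!: exI[of _ "[]"] simp: apply_reflections_def)
  next
    case False
    then obtain i where i: "1 \<le> i" "i < n" "\<not> inv w i < inv w (Suc i)"
      using permutes_without_descent[of "inv w" n] permutes_inv[OF less.prems] by blast
    have sur: "\<And>x. w (inv w x) = x"
      using less.prems by (simp add: permutes_inverses)
    have pos: "inv w (Suc i) < inv w i"
      using i(3) sur by (metis n_not_Suc_n not_less_iff_gr_or_eq)
    have range: "inv w (Suc i) \<in> {1..n}" "inv w i \<in> {1..n}"
      using i permutes_in_image[OF permutes_inv[OF less.prems]] by auto
    let ?s = "Transposition.transpose i (Suc i)"
    let ?v = "?s \<circ> w"
    have v: "?v permutes {1..n}"
      using i less.prems by (intro permutes_compose permutes_swap_id) auto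
    have undo: "?s \<circ> ?v = w"
      by (simp add: comp_assoc[symmetric])
    have "w = ?v \<circ> Transposition.transpose (inv w (Suc i)) (inv w i)"
      using swap_values_eq_swap_positions[OF permutes_inj[OF v], of "inv w (Suc i)" "inv w i"] undo
      by (simp add: sur)
    moreover have "card (inversions n ?v)
        < card (inversions n (?v \<circ> Transposition.transpose (inv w (Suc i)) (inv w i)))"
      using range pos by (intro card_inversions_swap) (auto simp: sur)
    ultimately have lt: "card (inversions n ?v) < card (inversions n w)"
      by simp
    have "card (inversions n w) \<le> Suc (card (inversions n ?v))"
      using card_inversions_simple_reflection[OF v, of i] undo by simp
    then have card: "card (inversions n w) = Suc (card (inversions n ?v))"
      using lt by simp
    obtain \<alpha>s where \<alpha>s: "length \<alpha>s = card (inversions n ?v)" "set \<alpha>s \<subseteq> simple_roots n"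
      "?v = apply_reflections \<alpha>s id"
      using less.hyps[OF lt v] by blast
    let ?\<alpha> = "unit_vector i - unit_vector (i + 1)"
    have "?\<alpha> \<in> simple_roots n"
      using i by (auto simp: simple_roots_def)
    moreover have "w = apply_reflections (\<alpha>s @ [?\<alpha>]) id"
      using undo \<alpha>s(3) by (simp add: reflection_root)
    ultimately show ?thesis
      using \<alpha>s card by (intro exI[of _ "\<alpha>s @ [?\<alpha>]"]) simp
  qed
qed

lemma coxeter_length_eq_card_inversions:
  assumes "w permutes {1..n}"
  shows "coxeter_length n w = card (inversions n w)"
  unfolding coxeter_length_def
  using reduced_word_exists[OF assms] apply_simple_reflections
  by (intro Least_equality) auto

section \<open>Bruhat chains as chains of position swaps\<close>

text \<open>Parametrised by the admissible roots, so that the same lemmas serve both kinds of chain: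
  \<open>roots n\<close> gives the Bruhat order, \<open>root_subset n g\<close> the chains in a good
  pair.\<close>

definition rise :: "nat \<Rightarrow> (nat \<Rightarrow> rat) set \<Rightarrow> (nat \<Rightarrow> nat) \<Rightarrow> (nat \<Rightarrow> nat) \<Rightarrow> bool" where
  "rise n R u v \<longleftrightarrow> (\<exists>\<alpha>\<in>R. v = reflection \<alpha> \<circ> u \<and> coxeter_length n u < coxeter_length n v)"

lemma bruhat_step_eq_rise: "bruhat_step n = rise n (roots n)"
  by (simp add: fun_eq_iff bruhat_step_def rise_def)

lemma root_subset_subset_roots: "root_subset n g \<subseteq> roots n"
  by (auto simp: root_subset_def)

lemma swap_permutes:
  fixes n p q :: nat
  assumes "u permutes {1..n}" "1 \<le> p" "p < q" "q \<le> n"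
  shows "u \<circ> Transposition.transpose p q permutes {1..n}"
proof -
  have "p \<in> {1..n}" "q \<in> {1..n}"
    using assms by simp_all
  then show ?thesis
    using assms(1) by (intro permutes_compose permutes_swap_id)
qed

text \<open>Reflections act on values, while inversions and ranks are read off at positions. The
  positions are sorted here but the orientation of the root is not known, hence the
  disjunction.\<close>

lemma riseE:
  assumes "rise n R u v" "R \<subseteq> roots n" "u permutes {1..n}"
  obtains p q where "1 \<le> p" "p < q" "q \<le> n" "u p < u q" "v = u \<circ> Transposition.transpose p q"
    "unit_vector (u p) - unit_vector (u q) \<in> R \<or> unit_vector (u q) - unit_vector (u p) \<in> R"
proof -
  obtain a b where ab: "a \<in> {1..n}" "b \<in> {1..n}" "a \<noteq> b" "unit_vector a - unit_vector b \<in> R"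
    "v = Transposition.transpose a b \<circ> u" "coxeter_length n u < coxeter_length n v"
    using assms(1,2) unfolding rise_def roots_def by (fastforce simp: reflection_root)
  define p q where "p = min (inv u a) (inv u b)" and "q = max (inv u a) (inv u b)"
  have sur: "u (inv u x) = x" for x
    using assms(3) by (simp add: permutes_inverses)
  have ne: "inv u a \<noteq> inv u b"
    using ab(3) sur by metis
  have in_range: "inv u a \<in> {1..n}" "inv u b \<in> {1..n}"
    using ab permutes_in_image[OF permutes_inv[OF assms(3)]] by auto
  have pq: "1 \<le> p" "p < q" "q \<le> n"
    using in_range ne by (auto simp: p_def q_def)
  have uv: "u p = a \<and> u q = b \<or> u p = b \<and> u q = a"
    by (auto simp: p_def q_def min_def max_def sur)
  then have v: "v = u \<circ> Transposition.transpose p q"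
    using ab(5) swap_values_eq_swap_positions[OF permutes_inj[OF assms(3)], of p q]
    by (auto simp: transpose_commute)
  have "v permutes {1..n}"
    unfolding v using assms(3) pq by (rule swap_permutes)
  then have "u p < u q"
    using ab(6) card_inversions_swap_iff[OF assms(3) pq]
      coxeter_length_eq_card_inversions[OF assms(3)] coxeter_length_eq_card_inversions[of v n]
    unfolding v by metis
  then show thesis
    using that pq v uv ab(4) by blast
qed

lemma riseI:
  assumes "u permutes {1..n}" "1 \<le> p" "p < q" "q \<le> n" "u p < u q"
    "unit_vector (u p) - unit_vector (u q) \<in> R"
  shows "rise n R u (u \<circ> Transposition.transpose p q)"
proof -
  have "u \<circ> Transposition.transpose p q = reflection (unit_vector (u p) - unit_vector (u q)) \<circ> u"
    using assms swap_values_eq_swap_positions[OF permutes_inj[OF assms(1)], of p q]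
    by (simp add: reflection_root)
  moreover have "coxeter_length n u < coxeter_length n (u \<circ> Transposition.transpose p q)"
    using assms swap_permutes[of u n p q] card_inversions_swap_iff[of u n p q]
    by (simp add: coxeter_length_eq_card_inversions)
  ultimately show ?thesis
    using assms(6) unfolding rise_def by blast
qed

lemma rise_permutes:
  assumes "rise n R u v" "R \<subseteq> roots n" "u permutes {1..n}"
  shows "v permutes {1..n}"
  using riseE[OF assms] swap_permutes[OF assms(3)] by metis

lemma rises_permutes:
  assumes "(rise n R)\<^sup>*\<^sup>* u v" "R \<subseteq> roots n" "u permutes {1..n}"
  shows "v permutes {1..n}"
  using assms(1) by (induction rule: rtranclp_induct) (use assms rise_permutes in blast)+

lemma unit_vector_diff_in_roots:
  assumes "i \<in> {1..n}" "j \<in> {1..n}" "i \<noteq> j"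
  shows "unit_vector i - unit_vector j \<in> roots n"
  using assms by (auto simp: roots_def)

lemma bruhat_le_swap:
  assumes "u permutes {1..n}" "1 \<le> p" "p < q" "q \<le> n" "u p < u q"
  shows "bruhat_le n u (u \<circ> Transposition.transpose p q)"
proof -
  have "p \<in> {1..n}" "q \<in> {1..n}"
    using assms by simp_all
  then have "u p \<in> {1..n}" "u q \<in> {1..n}"
    by (simp_all only: permutes_in_image[OF assms(1)])
  then have "rise n (roots n) u (u \<circ> Transposition.transpose p q)"
    using assms by (intro riseI unit_vector_diff_in_roots) auto
  then show ?thesis
    using assms(1) swap_permutes[OF assms(1-4)] unfolding bruhat_le_def bruhat_step_eq_rise
    by blast
qed

lemma bruhat_le_trans: "bruhat_le n u v \<Longrightarrow> bruhat_le n v w \<Longrightarrow> bruhat_le n u w"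
  by (auto simp: bruhat_le_def)

lemma rises_length:
  assumes "(rise n R)\<^sup>*\<^sup>* u v"
  shows "u = v \<or> coxeter_length n u < coxeter_length n v"
  using assms by (induction rule: rtranclp_induct) (auto simp: rise_def)

lemma apply_reflections_Nil [simp]: "apply_reflections [] w = w"
  by (simp add: apply_reflections_def)

text \<open>A rise is one Bruhat step and changes the length, so it is strict. Conversely a strict
  Bruhat relation forces a greater length, so a single reflection that realises it is a
  rise.\<close>

lemma rises_iff_word:
  assumes "R \<subseteq> roots n" "u permutes {1..n}"
  shows "(rise n R)\<^sup>*\<^sup>* u v \<longleftrightarrow> (\<exists>\<alpha>s. set \<alpha>s \<subseteq> R \<and> v = apply_reflections \<alpha>s u \<and>
    (\<forall>i\<in>{1..length \<alpha>s}. bruhat_less n (apply_reflections (take (i - 1) \<alpha>s) u)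
      (apply_reflections (take i \<alpha>s) u)))"
    (is "_ \<longleftrightarrow> (\<exists>\<alpha>s. ?word \<alpha>s v)")
proof
  assume "(rise n R)\<^sup>*\<^sup>* u v"
  then show "\<exists>\<alpha>s. ?word \<alpha>s v"
  proof (induction rule: rtranclp_induct)
    case base
    show ?case
      by (rule exI[of _ "[]"]) simp
  next
    case (step x y)
    then obtain \<alpha>s where \<alpha>s: "?word \<alpha>s x"
      by blast
    obtain \<alpha> where \<alpha>: "\<alpha> \<in> R" "y = reflection \<alpha> \<circ> x" "coxeter_length n x < coxeter_length n y"
      using step.hyps(2) by (auto simp: rise_def)
    have "x permutes {1..n}" "y permutes {1..n}"
      using step.hyps assms rises_permutes rise_permutes by blast+
    moreover have "rise n (roots n) x y"
      using \<alpha> assms by (auto simp: rise_def)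
    ultimately have less: "bruhat_less n x y"
      using \<alpha>(3) by (auto simp: bruhat_less_def bruhat_le_def bruhat_step_eq_rise)
    have "?word (\<alpha>s @ [\<alpha>]) y"
    proof (intro conjI ballI)
      fix i assume i: "i \<in> {1..length (\<alpha>s @ [\<alpha>])}"
      show "bruhat_less n (apply_reflections (take (i - 1) (\<alpha>s @ [\<alpha>])) u)
        (apply_reflections (take i (\<alpha>s @ [\<alpha>])) u)"
      proof (cases "i = Suc (length \<alpha>s)")
        case True
        then show ?thesis
          using \<alpha>s \<alpha> less by simp
      next
        case False
        then show ?thesis
          using i \<alpha>s by auto
      qed
    qed (use \<alpha>s \<alpha> in auto)
    then show ?case
      by blast
  qed
next
  assume "\<exists>\<alpha>s. ?word \<alpha>s v"
  then obtain \<alpha>s where "?word \<alpha>s v"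
    by blast
  then show "(rise n R)\<^sup>*\<^sup>* u v"
  proof (induction \<alpha>s arbitrary: v rule: rev_induct)
    case Nil
    then show ?case
      by simp
  next
    case (snoc \<alpha> \<alpha>s)
    let ?x = "apply_reflections \<alpha>s u"
    have each: "bruhat_less n (apply_reflections (take (i - 1) \<alpha>s) u)
        (apply_reflections (take i \<alpha>s) u)" if "i \<in> {1..length \<alpha>s}" for i
      using snoc.prems that by (auto dest!: bspec[of _ _ i])
    have "?word \<alpha>s ?x"
      using snoc.prems each by auto
    then have x: "(rise n R)\<^sup>*\<^sup>* u ?x"
      by (rule snoc.IH)
    have v: "v = reflection \<alpha> \<circ> ?x"
      using snoc.prems unfolding apply_reflections_snoc by blast
    have \<alpha>: "\<alpha> \<in> R"
      using snoc.prems by simp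
    have "Suc (length \<alpha>s) \<in> {1..length (\<alpha>s @ [\<alpha>])}"
      by simp
    then have "bruhat_less n (apply_reflections (take (length \<alpha>s) (\<alpha>s @ [\<alpha>])) u)
        (apply_reflections (take (Suc (length \<alpha>s)) (\<alpha>s @ [\<alpha>])) u)"
      using snoc.prems by (metis diff_Suc_1)
    moreover have "take (length \<alpha>s) (\<alpha>s @ [\<alpha>]) = \<alpha>s"
      "take (Suc (length \<alpha>s)) (\<alpha>s @ [\<alpha>]) = \<alpha>s @ [\<alpha>]"
      by simp_all
    ultimately have "bruhat_less n ?x v"
      using snoc.prems by metis
    then have "coxeter_length n ?x < coxeter_length n v"
      using rises_length by (auto simp: bruhat_less_def bruhat_le_def bruhat_step_eq_rise)
    then have "rise n R ?x v"
      using v \<alpha> unfolding rise_def by blast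
    then show ?case
      using x by simp
  qed
qed

lemma good_pair_iff_rises:
  assumes "u permutes {1..n}"
  shows "good_pair n u w \<longleftrightarrow>
    bruhat_le n u w \<and> (rise n (root_subset n (u \<circ> inv w)))\<^sup>*\<^sup>* u w"
  unfolding good_pair_def rises_iff_word[OF root_subset_subset_roots assms] ..

section \<open>Rank functions on blocks of positions\<close>

text \<open>For \<open>C = {1..n}\<close> this counts the points in a corner of the permutation
  matrix, as in the tableau criterion. One test is strict and the other weak, so
  \<open>(p, v)\<close> acts as a grid point between cells; \<open>corank\<close> counts the
  opposite corner.\<close>

definition rank :: "nat set \<Rightarrow> (nat \<Rightarrow> nat) \<Rightarrow> nat \<Rightarrow> nat \<Rightarrow> nat" where
  "rank C u p v = card {j \<in> C. j < p \<and> v \<le> u j}"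

definition corank :: "nat set \<Rightarrow> (nat \<Rightarrow> nat) \<Rightarrow> nat \<Rightarrow> nat \<Rightarrow> nat" where
  "corank C u p v = card {j \<in> C. p \<le> j \<and> u j < v}"

text \<open>The points left of \<open>p\<close> and below \<open>v\<close> enter both auxiliary
  counts and cancel. Thus \<open>rank\<close> and \<open>corank\<close> differ by a quantity that
  depends only on \<open>C\<close>, its image and \<open>(p, v)\<close>: for maps with the same
  image, comparing ranks is comparing coranks.\<close>

lemma rank_corank:
  assumes "finite C" "inj_on u C"
  shows "rank C u p v + card {x \<in> u ` C. x < v} = corank C u p v + card {j \<in> C. j < p}"
proof -
  let ?SW = "{j \<in> C. j < p \<and> u j < v}"
  have "{x \<in> u ` C. x < v} = u ` {j \<in> C. u j < v}"
    by auto
  then have "card {x \<in> u ` C. x < v} = card {j \<in> C. u j < v}"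
    using assms by (simp add: card_image inj_on_subset)
  also have "{j \<in> C. u j < v} = {j \<in> C. p \<le> j \<and> u j < v} \<union> ?SW"
    by auto
  also have "card \<dots> = corank C u p v + card ?SW"
    unfolding corank_def using assms by (intro card_Un_disjoint) auto
  finally have 1: "card {x \<in> u ` C. x < v} = corank C u p v + card ?SW" .
  have "{j \<in> C. j < p} = {j \<in> C. j < p \<and> v \<le> u j} \<union> ?SW"
    by auto
  also have "card \<dots> = rank C u p v + card ?SW"
    unfolding rank_def using assms by (intro card_Un_disjoint) auto
  finally show ?thesis
    using 1 by simp
qed

text \<open>If \<open>x \<le> q\<close>, position \<open>q\<close> is not counted and the value at
  \<open>p\<close> only grows. Otherwise both positions are left of \<open>x\<close> and merely
  exchange their values.\<close>

lemma rank_swap_mono: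
  assumes "finite C" "p \<in> C" "q \<in> C" "p < q" "u p < u q"
  shows "rank C u x v \<le> rank C (u \<circ> Transposition.transpose p q) x v"
proof (cases "x \<le> q")
  case True
  then have "{j \<in> C. j < x \<and> v \<le> u j} \<subseteq> {j \<in> C. j < x \<and> v \<le> (u \<circ> Transposition.transpose p q) j}"
    using assms by (auto simp: transpose_def)
  then show ?thesis
    unfolding rank_def using assms(1) by (intro card_mono) auto
next
  case False
  then have "Transposition.transpose p q ` {j \<in> C. j < x \<and> v \<le> u j}
      \<subseteq> {j \<in> C. j < x \<and> v \<le> (u \<circ> Transposition.transpose p q) j}"
    using assms by (auto simp: transpose_def)
  then have "card (Transposition.transpose p q ` {j \<in> C. j < x \<and> v \<le> u j})
      \<le> rank C (u \<circ> Transposition.transpose p q) x v"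
    unfolding rank_def using assms(1) by (intro card_mono) auto
  then show ?thesis
    by (simp add: rank_def card_image)
qed

lemma rank_cong:
  assumes "\<And>j. j \<in> C \<Longrightarrow> u j = u' j"
  shows "rank C u x v = rank C u' x v"
proof -
  have "{j \<in> C. j < x \<and> v \<le> u j} = {j \<in> C. j < x \<and> v \<le> u' j}"
    using assms by auto
  then show ?thesis
    by (simp add: rank_def)
qed

lemma rise_rank:
  assumes "rise n R u v" "R \<subseteq> roots n" "u permutes {1..n}" "C \<subseteq> {1..n}" "u ` C = V"
    and sep: "\<And>a b. unit_vector a - unit_vector b \<in> R \<Longrightarrow> a \<in> V \<longleftrightarrow> b \<in> V"
  shows "v ` C = V \<and> (\<forall>x y. rank C u x y \<le> rank C v x y)"
proof -
  obtain p q where pq: "1 \<le> p" "p < q" "q \<le> n" "u p < u q"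
    "v = u \<circ> Transposition.transpose p q"
    "unit_vector (u p) - unit_vector (u q) \<in> R \<or> unit_vector (u q) - unit_vector (u p) \<in> R"
    using riseE[OF assms(1-3)] by metis
  have fin: "finite C"
    using assms(4) by (rule finite_subset) simp
  have "u p \<in> V \<longleftrightarrow> u q \<in> V"
    using pq(6) sep by blast
  then have pqC: "p \<in> C \<longleftrightarrow> q \<in> C"
    using assms(5) permutes_inj[OF assms(3)] by (auto dest: injD)
  then have "Transposition.transpose p q ` C = C"
    by simp
  then have "v ` C = V"
    using assms(5) unfolding pq(5) image_comp[symmetric] by simp
  moreover have "rank C u x y \<le> rank C v x y" for x y
  proof (cases "p \<in> C")
    case True
    then show ?thesis
      using rank_swap_mono[OF fin True _ pq(2,4)] pqC pq(5) by simp
  next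
    case False
    then have "rank C u x y = rank C v x y"
      using pqC pq(5) by (intro rank_cong) (auto simp: transpose_def)
    then show ?thesis
      by simp
  qed
  ultimately show ?thesis
    by blast
qed

lemma rises_rank:
  assumes "(rise n R)\<^sup>*\<^sup>* u v" "R \<subseteq> roots n" "u permutes {1..n}" "C \<subseteq> {1..n}" "u ` C = V"
    and "\<And>a b. unit_vector a - unit_vector b \<in> R \<Longrightarrow> a \<in> V \<longleftrightarrow> b \<in> V"
  shows "v ` C = V \<and> (\<forall>x y. rank C u x y \<le> rank C v x y)"
  using assms(1)
proof (induction rule: rtranclp_induct)
  case base
  then show ?case
    using assms(5) by simp
next
  case (step x y)
  have "x permutes {1..n}"
    using rises_permutes[OF step.hyps(1) assms(2,3)] .
  from rise_rank[OF step.hyps(2) assms(2) this assms(4) _ assms(6)] step.IH show ?case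
    by (meson le_trans)
qed

text \<open>The block of all positions in \<open>rises_rank\<close>; separation then only asks that
  both indices of a root lie in range.\<close>

lemma bruhat_le_rank:
  assumes "bruhat_le n u w"
  shows "rank {1..n} u x y \<le> rank {1..n} w x y"
proof -
  have u: "u permutes {1..n}" and chain: "(rise n (roots n))\<^sup>*\<^sup>* u w"
    using assms by (auto simp: bruhat_le_def bruhat_step_eq_rise)
  have "a \<in> {1..n} \<longleftrightarrow> b \<in> {1..n}" if root: "unit_vector a - unit_vector b \<in> roots n" for a b
  proof (cases "a = b")
    case False
    obtain i j where ij: "i \<in> {1..n}" "j \<in> {1..n}" "i \<noteq> j"
      "unit_vector a - unit_vector b = unit_vector i - unit_vector j"
      using root by (auto simp: roots_def)
    have "(unit_vector a - unit_vector b) a = (unit_vector i - unit_vector j) a"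
      "(unit_vector a - unit_vector b) b = (unit_vector i - unit_vector j) b"
      using ij(4) by simp_all
    then have "a = i" "b = j"
      using False by (auto simp: unit_vector_def split: if_splits)
    then show ?thesis
      using ij by simp
  qed simp
  from rises_rank[OF chain order_refl u order_refl permutes_image[OF u] this] show ?thesis
    by blast
qed

section \<open>Stable sets of values and the necessity of the rank conditions\<close>

text \<open>
  The coordinates of \<open>g v - v\<close> sum to zero over every set of indices stable under \<open>g\<close>.
\<close>

lemma root_subset_separation:
  assumes "unit_vector a - unit_vector b \<in> root_subset n g" "g permutes {1..n}"
    "V \<subseteq> {1..n}" "g ` V = V"
  shows "a \<in> V \<longleftrightarrow> b \<in> V"
proof -
  obtain v where v: "unit_vector a - unit_vector b = perm_action g v - v"
    using assms(1) by (auto simp: root_subset_def)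
  have fin: "finite V"
    using assms(3) by (rule finite_subset) simp
  have inv: "inv g ` V = V"
    using assms(4) by (metis assms(2) image_inv_f_f permutes_inj)
  have "(\<Sum>k\<in>V. (perm_action g v - v) k) = (\<Sum>k\<in>V. v (inv g k)) - (\<Sum>k\<in>V. v k)"
    by (simp add: perm_action_def sum_subtractf)
  also have "(\<Sum>k\<in>V. v (inv g k)) = (\<Sum>k\<in>inv g ` V. v k)"
    using permutes_inj[OF permutes_inv[OF assms(2)]]
    by (subst sum.reindex) (auto intro: inj_on_subset)
  finally have "(\<Sum>k\<in>V. (unit_vector a - unit_vector b) k) = 0"
    unfolding v inv by simp
  moreover have "(\<Sum>k\<in>V. (unit_vector a - unit_vector b) k)
      = (if a \<in> V then 1 else 0) - (if b \<in> V then 1 else (0::rat))"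
    using fin by (simp add: unit_vector_def sum_subtractf)
  ultimately show ?thesis
    by (auto split: if_splits)
qed

text \<open>Equality of the two images of \<open>C\<close> means that \<open>w\<close> carries
  \<open>C\<close> onto a set stable under \<open>u \<circ> inv w\<close>. No root of
  \<open>root_subset\<close> crosses the boundary of that set.\<close>

lemma good_pair_rank:
  assumes "good_pair n u w" "C \<subseteq> {1..n}" "u ` C = w ` C"
  shows "rank C u x y \<le> rank C w x y"
proof -
  have u: "u permutes {1..n}" and w: "w permutes {1..n}"
    using assms(1) by (auto simp: good_pair_def bruhat_le_def)
  let ?g = "u \<circ> inv w"
  have g: "?g permutes {1..n}"
    using u w by (intro permutes_compose permutes_inv)
  have "inv w ` w ` C = C"
    using permutes_inj[OF w] by (rule image_inv_f_f)
  then have "?g ` (w ` C) = w ` C"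
    using assms(3) unfolding image_comp[symmetric] by simp
  moreover have "w ` C \<subseteq> {1..n}"
    using assms(2) permutes_image[OF w] by blast
  ultimately have sep: "a \<in> w ` C \<longleftrightarrow> b \<in> w ` C"
    if "unit_vector a - unit_vector b \<in> root_subset n ?g" for a b
    using root_subset_separation[OF that g] by blast
  have "(rise n (root_subset n ?g))\<^sup>*\<^sup>* u w"
    using assms(1) good_pair_iff_rises[OF u] by blast
  from rises_rank[OF this root_subset_subset_roots u assms(2,3) sep] show ?thesis
    by blast
qed

section \<open>Chains of swaps from rank domination\<close>

lemma rank_split:
  assumes "finite C" "y \<le> Suc b"
  shows "rank C u x y = rank C u x (Suc b) + card {j \<in> C. j < x \<and> y \<le> u j \<and> u j \<le> b}"
proof -
  let ?A = "{j \<in> C. j < x \<and> Suc b \<le> u j}" and ?B = "{j \<in> C. j < x \<and> y \<le> u j \<and> u j \<le> b}"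
  have eq: "{j \<in> C. j < x \<and> y \<le> u j} = ?A \<union> ?B"
    using assms(2) by auto
  have "card (?A \<union> ?B) = card ?A + card ?B"
    using assms(1) by (intro card_Un_disjoint) auto
  then show ?thesis
    unfolding rank_def eq .
qed

text \<open>A swap alters the count only at grid points of the rectangle spanned by the two points;
  this is the bound complementary to \<open>rank_swap_mono\<close>.\<close>

lemma rank_swap_le:
  assumes "finite C" "p \<in> C" "q \<in> C" "p < q" "u p < u q" "\<not> (p < x \<and> x \<le> q \<and> u p < y \<and> y \<le> u q)"
  shows "rank C (u \<circ> Transposition.transpose p q) x y \<le> rank C u x y"
proof (cases "x \<le> q")
  case True
  then have "{j \<in> C. j < x \<and> y \<le> (u \<circ> Transposition.transpose p q) j} \<subseteq> {j \<in> C. j < x \<and> y \<le> u j}"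
    using assms by (auto simp: transpose_def split: if_splits)
  then show ?thesis
    unfolding rank_def using assms(1) by (intro card_mono) auto
next
  case False
  then have "Transposition.transpose p q ` {j \<in> C. j < x \<and> y \<le> (u \<circ> Transposition.transpose p q) j}
      \<subseteq> {j \<in> C. j < x \<and> y \<le> u j}"
    using assms by (auto simp: transpose_def)
  then have "card (Transposition.transpose p q ` {j \<in> C. j < x \<and> y \<le> (u \<circ> Transposition.transpose p q) j})
      \<le> rank C u x y"
    unfolding rank_def using assms(1) by (intro card_mono) auto
  then show ?thesis
    by (simp add: rank_def card_image)
qed

text \<open>
  Swap the first position \<open>p\<close> where \<open>u\<close> and \<open>w\<close> differ with the next position \<open>q\<close> whose value
  lies in \<open>{u p<..w p}\<close>; no value of \<open>u\<close> in this range occurs between \<open>p\<close> and \<open>q\<close>.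
\<close>

lemma rank_le_swap:
  assumes fin: "finite C" and inj: "inj_on w C" and img: "u ` C = w ` C"
    and le: "\<And>x y. rank C u x y \<le> rank C w x y" and ne: "\<exists>j\<in>C. u j \<noteq> w j"
  obtains p q where "p \<in> C" "q \<in> C" "p < q" "u p < u q"
    "\<And>x y. rank C (u \<circ> Transposition.transpose p q) x y \<le> rank C w x y"
proof -
  define p where "p = (LEAST j. j \<in> C \<and> u j \<noteq> w j)"
  have p: "p \<in> C" "u p \<noteq> w p"
    using ne LeastI_ex[of "\<lambda>j. j \<in> C \<and> u j \<noteq> w j"] by (auto simp: p_def)
  have before: "u j = w j" if "j \<in> C" "j < p" for j
    using that not_less_Least[of j "\<lambda>j. j \<in> C \<and> u j \<noteq> w j"] by (auto simp: p_def)
  \<comment> \<open>Otherwise the corner at \<open>(Suc p, u p)\<close> counts \<open>p\<close> for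
    \<open>u\<close> only, while \<open>u\<close> and \<open>w\<close> agree on all earlier
    positions of \<open>C\<close>.\<close>
  have up: "u p < w p"
  proof (rule ccontr)
    assume "\<not> u p < w p"
    then have lt: "w p < u p"
      using p(2) by simp
    have "{j \<in> C. j < Suc p \<and> u p \<le> w j} \<subset> {j \<in> C. j < Suc p \<and> u p \<le> u j}"
    proof (rule psubsetI)
      show "{j \<in> C. j < Suc p \<and> u p \<le> w j} \<subseteq> {j \<in> C. j < Suc p \<and> u p \<le> u j}"
      proof
        fix j assume j: "j \<in> {j \<in> C. j < Suc p \<and> u p \<le> w j}"
        then have "j \<noteq> p"
          using lt by auto
        then show "j \<in> {j \<in> C. j < Suc p \<and> u p \<le> u j}"
          using j before[of j] by simp
      qed
      have "p \<in> {j \<in> C. j < Suc p \<and> u p \<le> u j}" "p \<notin> {j \<in> C. j < Suc p \<and> u p \<le> w j}"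
        using p(1) lt by simp_all
      then show "{j \<in> C. j < Suc p \<and> u p \<le> w j} \<noteq> {j \<in> C. j < Suc p \<and> u p \<le> u j}"
        by blast
    qed
    then have "rank C w (Suc p) (u p) < rank C u (Suc p) (u p)"
      unfolding rank_def using fin by (intro psubset_card_mono) auto
    then show False
      using le[of "Suc p" "u p"] by simp
  qed
  define Q where "Q = (\<lambda>j. j \<in> C \<and> p < j \<and> u p < u j \<and> u j \<le> w p)"
  obtain j where j: "j \<in> C" "u j = w p"
    using img p(1) by (metis imageE imageI)
  \<comment> \<open>Left of \<open>p\<close> the two maps agree and \<open>w\<close> is injective,
    so under \<open>u\<close> the value \<open>w p\<close> can occur only to the right. This
    guarantees that \<open>q\<close> exists.\<close>
  have "p < j"
    using j p before inj by (metis inj_onD nat_neq_iff)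
  then have "Q j"
    using j up by (simp add: Q_def)
  define q where "q = (LEAST j. Q j)"
  have "Q q"
    using \<open>Q j\<close> by (auto simp: q_def intro: LeastI)
  then have q: "q \<in> C" "p < q" "u p < u q" "u q \<le> w p"
    by (auto simp: Q_def)
  have between: "\<not> Q j" if "j < q" for j
    using that not_less_Least by (auto simp: q_def)
  have "rank C (u \<circ> Transposition.transpose p q) x y \<le> rank C w x y" for x y
  proof (cases "p < x \<and> x \<le> q \<and> u p < y \<and> y \<le> u q")
    case True
    have "{j \<in> C. j < x \<and> y \<le> (u \<circ> Transposition.transpose p q) j} \<subseteq> insert p {j \<in> C. j < x \<and> y \<le> u j}"
      using True by (auto simp: transpose_def split: if_splits)
    then have "rank C (u \<circ> Transposition.transpose p q) x y \<le> card (insert p {j \<in> C. j < x \<and> y \<le> u j})"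
      unfolding rank_def using fin by (intro card_mono) auto
    also have "\<dots> \<le> Suc (rank C u x y)"
      by (simp add: rank_def card_insert_le_m1 card_insert_if fin)
    finally have 1: "rank C (u \<circ> Transposition.transpose p q) x y \<le> Suc (rank C u x y)" .
    \<comment> \<open>Source of the unit that the swap uses up: left of \<open>x\<close>, the values
      of \<open>u\<close> in \<open>{y..w p}\<close> occur before \<open>p\<close> by the choice of
      \<open>q\<close>, where \<open>u\<close> and \<open>w\<close> agree, and \<open>w\<close> has
      the additional point at \<open>p\<close>. Above \<open>w p\<close> the hypothesis
      \<open>le\<close> applies.\<close>
    have "{j \<in> C. j < x \<and> y \<le> u j \<and> u j \<le> w p} \<subset> {j \<in> C. j < x \<and> y \<le> w j \<and> w j \<le> w p}"
    proof (rule psubsetI)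
      show "{j \<in> C. j < x \<and> y \<le> u j \<and> u j \<le> w p} \<subseteq> {j \<in> C. j < x \<and> y \<le> w j \<and> w j \<le> w p}"
      proof
        fix j assume j: "j \<in> {j \<in> C. j < x \<and> y \<le> u j \<and> u j \<le> w p}"
        then have "j < p"
          using True between[of j] unfolding Q_def by (cases j p rule: linorder_cases) auto
        then show "j \<in> {j \<in> C. j < x \<and> y \<le> w j \<and> w j \<le> w p}"
          using j before[of j] by simp
      qed
      show "{j \<in> C. j < x \<and> y \<le> u j \<and> u j \<le> w p} \<noteq> {j \<in> C. j < x \<and> y \<le> w j \<and> w j \<le> w p}"
        using True p q by (auto simp: set_eq_iff intro!: exI[of _ p])
    qed
    then have "card {j \<in> C. j < x \<and> y \<le> u j \<and> u j \<le> w p} < card {j \<in> C. j < x \<and> y \<le> w j \<and> w j \<le> w p}"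
      using fin by (intro psubset_card_mono) auto
    moreover have "y \<le> Suc (w p)"
      using True q by simp
    ultimately have "rank C u x y < rank C w x y"
      using rank_split[OF fin, of y "w p" u x] rank_split[OF fin, of y "w p" w x]
        le[of x "Suc (w p)"] by linarith
    then show ?thesis
      using 1 by simp
  next
    case False
    then show ?thesis
      using rank_swap_le[OF fin p(1) q(1,2,3)] le le_trans by blast
  qed
  then show thesis
    using that p q by blast
qed

text \<open>The tableau criterion on all blocks of a partition at once. A swap inside one block
  leaves the restrictions of \<open>u\<close> to the other blocks unchanged. Inversions increase
  with each swap and never exceed \<open>n * n\<close>, which makes the induction terminate.\<close>

lemma rises_of_rank_le:
  assumes "u permutes {1..n}" "w permutes {1..n}" "R \<subseteq> roots n"
    and cover: "\<Union>\<C> = {1..n}" and disj: "pairwise disjnt \<C>"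
    and full: "\<And>C a b. C \<in> \<C> \<Longrightarrow> a \<in> w ` C \<Longrightarrow> b \<in> w ` C \<Longrightarrow> a \<noteq> b \<Longrightarrow> unit_vector a - unit_vector b \<in> R"
    and "\<And>C. C \<in> \<C> \<Longrightarrow> u ` C = w ` C"
    and "\<And>C x y. C \<in> \<C> \<Longrightarrow> rank C u x y \<le> rank C w x y"
  shows "(rise n R)\<^sup>*\<^sup>* u w"
  using assms(1,7,8)
proof (induction "n * n - card (inversions n u)" arbitrary: u rule: less_induct)
  case less
  note u = less.prems(1) and img = less.prems(2) and le = less.prems(3)
  show ?case
  proof (cases "u = w")
    case False
    then obtain j where j: "u j \<noteq> w j"
      by auto
    then have "j \<in> {1..n}"
      using u assms(2) by (metis permutes_not_in)
    then obtain C where C: "C \<in> \<C>" "j \<in> C"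
      using cover by blast
    have sub: "C \<subseteq> {1..n}"
      using C cover by blast
    have fin: "finite C"
      using sub by (rule finite_subset) simp
    have inj: "inj_on w C"
      using permutes_inj[OF assms(2)] by (rule inj_on_subset) simp
    obtain p q where pq: "p \<in> C" "q \<in> C" "p < q" "u p < u q"
      and rk: "\<And>x y. rank C (u \<circ> Transposition.transpose p q) x y \<le> rank C w x y"
      using rank_le_swap[OF fin inj img[OF C(1)] le[OF C(1)]] C(2) j by blast
    let ?u = "u \<circ> Transposition.transpose p q"
    have range: "1 \<le> p" "q \<le> n"
      using pq sub by auto
    have perm: "?u permutes {1..n}"
      using u range pq by (intro swap_permutes)
    have "u p \<in> w ` C" "u q \<in> w ` C"
      using pq img[OF C(1)] by blast+
    then have "rise n R u ?u"
      using pq by (intro riseI[OF u range(1) pq(3) range(2) pq(4)] full[OF C(1)]) auto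
    moreover have "(rise n R)\<^sup>*\<^sup>* ?u w"
    proof (rule less.hyps)
      have "inversions n ?u \<subseteq> {1..n} \<times> {1..n}"
        by (auto simp: inversions_def)
      then have "card (inversions n ?u) \<le> card ({1..n} \<times> {1..n})"
        by (intro card_mono) auto
      then have "card (inversions n ?u) \<le> n * n"
        by (simp add: card_cartesian_product)
      then show "n * n - card (inversions n ?u) < n * n - card (inversions n u)"
        using card_inversions_swap[OF range(1) pq(3) range(2) pq(4)] by linarith
      show "?u permutes {1..n}"
        by (rule perm)
      fix C' assume C': "C' \<in> \<C>"
      have "p \<in> C' \<longleftrightarrow> q \<in> C'" "C' \<noteq> C \<Longrightarrow> p \<notin> C'"
        using pq C C' disj by (auto simp: pairwise_def disjnt_def)
      note mem = this
      show "?u ` C' = w ` C'"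
        using mem(1) img[OF C'] unfolding image_comp[symmetric] by simp
      fix x y
      show "rank C' ?u x y \<le> rank C' w x y"
      proof (cases "C' = C")
        case True
        then show ?thesis
          using rk by simp
      next
        case False
        then have "rank C' ?u x y = rank C' u x y"
          using mem by (intro rank_cong) (auto simp: transpose_def)
        then show ?thesis
          using le[OF C'] by simp
      qed
    qed
    ultimately show ?thesis
      by (rule converse_rtranclp_into_rtranclp)
  qed simp
qed

section \<open>Blocks of indices joined through the image of g - 1\<close>

definition linked :: "nat \<Rightarrow> (nat \<Rightarrow> nat) \<Rightarrow> nat \<Rightarrow> nat \<Rightarrow> bool" where
  "linked n g a b \<longleftrightarrow> unit_vector a - unit_vector b \<in> (\<lambda>v. perm_action g v - v) ` rat_space n"

lemma linkedI:
  assumes "v \<in> rat_space n" "\<And>k. unit_vector a k - unit_vector b k = v (inv g k) - v k"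
  shows "linked n g a b"
  unfolding linked_def using assms by (intro image_eqI[of _ _ v]) (auto simp: perm_action_def)

lemma linkedE:
  assumes "linked n g a b"
  obtains v where "v \<in> rat_space n" "\<And>k. unit_vector a k - unit_vector b k = v (inv g k) - v k"
proof -
  obtain v where v: "v \<in> rat_space n" "unit_vector a - unit_vector b = perm_action g v - v"
    using assms by (auto simp: linked_def)
  then show thesis
    using that[of v] by (simp add: fun_eq_iff perm_action_def)
qed

lemma linked_refl: "linked n g a a"
  by (rule linkedI[of "\<lambda>_. 0"]) (auto simp: rat_space_def)

lemma linked_sym:
  assumes "linked n g a b"
  shows "linked n g b a"
proof -
  obtain v where v: "v \<in> rat_space n" "\<And>k. unit_vector a k - unit_vector b k = v (inv g k) - v k"
    using linkedE[OF assms] by blast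
  have "unit_vector b k - unit_vector a k = - v (inv g k) - (- v k)" for k
    using v(2)[of k] by simp
  then show ?thesis
    using v(1) by (intro linkedI[of "\<lambda>k. - v k"]) (auto simp: rat_space_def)
qed

lemma linked_trans:
  assumes "linked n g a b" "linked n g b c"
  shows "linked n g a c"
proof -
  obtain v where v: "v \<in> rat_space n" "\<And>k. unit_vector a k - unit_vector b k = v (inv g k) - v k"
    using linkedE[OF assms(1)] by blast
  obtain v' where v': "v' \<in> rat_space n" "\<And>k. unit_vector b k - unit_vector c k = v' (inv g k) - v' k"
    using linkedE[OF assms(2)] by blast
  have "unit_vector a k - unit_vector c k = v (inv g k) + v' (inv g k) - (v k + v' k)" for k
    using v(2)[of k] v'(2)[of k] by simp
  then show ?thesis
    using v(1) v'(1) by (intro linkedI[of "\<lambda>k. v k + v' k"]) (auto simp: rat_space_def)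
qed

lemma linked_step:
  assumes "g permutes {1..n}" "a \<in> {1..n}"
  shows "linked n g (g a) a"
proof -
  have "unit_vector a \<in> rat_space n"
    using assms(2) by (auto simp: rat_space_def unit_vector_def)
  then show ?thesis
    unfolding linked_def using perm_action_unit_vector[OF assms(1), of a]
    by (intro image_eqI[of _ _ "unit_vector a"]) simp_all
qed

text \<open>Within a class of \<open>linked\<close> all differences of distinct unit vectors are
  roots of \<open>root_subset\<close>, so every transposition inside the class is admissible and
  \<open>rises_of_rank_le\<close> applies to the partition into classes.\<close>

lemma good_pair_of_rank_le:
  assumes "bruhat_le n u w"
    and le: "\<And>C x y. C \<subseteq> {1..n} \<Longrightarrow> u ` C = w ` C \<Longrightarrow> rank C u x y \<le> rank C w x y"
  shows "good_pair n u w"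
proof -
  have u: "u permutes {1..n}" and w: "w permutes {1..n}"
    using assms(1) by (auto simp: bruhat_le_def)
  let ?g = "u \<circ> inv w"
  have g: "?g permutes {1..n}"
    using u w by (intro permutes_compose permutes_inv)
  \<comment> \<open>\<open>linked\<close> is an equivalence relation because the image of g - 1 is a
    linear subspace. \<open>B j\<close> is a class of values, pulled back to positions along
    \<open>w\<close>.\<close>
  define B where "B = (\<lambda>j. {i \<in> {1..n}. linked n ?g (w i) (w j)})"
  have img: "u ` B j = w ` B j" for j
  proof -
    have "u ` B j \<subseteq> w ` B j"
    proof
      fix x assume "x \<in> u ` B j"
      then obtain i where i: "i \<in> {1..n}" "linked n ?g (w i) (w j)" "x = u i"
        by (auto simp: B_def)
      have "w i \<in> {1..n}"
        using i(1) permutes_in_image[OF w] by blast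
      \<comment> \<open>\<open>?g\<close> sends \<open>w i\<close> to \<open>u i\<close>.\<close>
      then have "linked n ?g (u i) (w i)"
        using linked_step[OF g] inv_f_f[OF permutes_inj[OF w]] by fastforce
      then have x: "linked n ?g x (w j)"
        using i linked_trans by blast
      have "x \<in> {1..n}"
        unfolding i(3) using i(1) permutes_in_image[OF u] by blast
      then obtain k where "k \<in> {1..n}" "x = w k"
        using permutes_image[OF w] by blast
      then show "x \<in> w ` B j"
        using x by (auto simp: B_def)
    qed
    moreover have "finite (w ` B j)"
      by (simp add: B_def)
    moreover have "card (u ` B j) = card (w ` B j)"
      using permutes_inj[OF u] permutes_inj[OF w] by (simp add: card_image inj_on_subset)
    ultimately show ?thesis
      by (simp add: card_subset_eq)
  qed
  have sub: "B j \<subseteq> {1..n}" for j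
    by (auto simp: B_def)
  have "(rise n (root_subset n ?g))\<^sup>*\<^sup>* u w"
  proof (rule rises_of_rank_le[OF u w root_subset_subset_roots, of "B ` {1..n}"])
    show "\<Union> (B ` {1..n}) = {1..n}"
      using linked_refl by (auto simp: B_def)
    show "pairwise disjnt (B ` {1..n})"
    proof (rule pairwiseI)
      fix X Y assume "X \<in> B ` {1..n}" "Y \<in> B ` {1..n}" "X \<noteq> Y"
      then show "disjnt X Y"
        using linked_sym linked_trans unfolding B_def disjnt_def by blast
    qed
    fix C assume "C \<in> B ` {1..n}"
    then obtain j where C: "C = B j"
      by blast
    show "u ` C = w ` C"
      using C img by simp
    show "rank C u x y \<le> rank C w x y" for x y
      using C img sub le by simp
    fix a b assume ab: "a \<in> w ` C" "b \<in> w ` C" "a \<noteq> b"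
    then have "linked n ?g a b"
      using C linked_sym linked_trans unfolding B_def by blast
    moreover have "a \<in> {1..n}" "b \<in> {1..n}"
      using ab C sub[of j] permutes_image[OF w] by blast+
    ultimately show "unit_vector a - unit_vector b \<in> root_subset n ?g"
      using ab(3) unit_vector_diff_in_roots by (simp add: root_subset_def linked_def)
  qed
  then show ?thesis
    using assms(1) good_pair_iff_rises[OF u] by blast
qed

section \<open>Rank violations and patterns\<close>

text \<open>
  The point \<open>(p, v)\<close> of a rank violation can be moved, while the violation persists and
  \<open>rank C w p v + corank C w p v\<close> decreases, until it sits at a corner as in the conclusion
  (an essential box of \<open>w\<close> restricted to \<open>C\<close>).
\<close>

lemma rank_violation_corner:
  assumes "finite C" "inj_on u C" "inj_on w C" "u ` C = w ` C" "rank C w p v < rank C u p v"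
  shows "\<exists>p0 p1 d c j k. {p0, p1, d, c, j, k} \<subseteq> C \<and> p0 < p1 \<and> d \<le> p0 \<and> p1 \<le> c \<and>
    w p0 \<le> w d \<and> w d < w c \<and> w c \<le> w p1 \<and> j \<le> p0 \<and> w c \<le> u j \<and> p1 \<le> k \<and> u k \<le> w d"
  using assms(5)
proof (induction "rank C w p v + corank C w p v" arbitrary: p v rule: less_induct)
  case less
  note fin = assms(1) and img = assms(4) and viol = less.prems
  \<comment> \<open>Equal images turn the violation into one of the opposite corner. So
    \<open>u\<close> has a point in each of the two corners, and these become \<open>j\<close> and
    \<open>k\<close>.\<close>
  have "corank C w p v < corank C u p v"
    using rank_corank[OF fin assms(2), of p v] rank_corank[OF fin assms(3), of p v] img viol by simp
  then have "{j \<in> C. j < p \<and> v \<le> u j} \<noteq> {}" "{j \<in> C. p \<le> j \<and> u j < v} \<noteq> {}"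
    using viol unfolding rank_def corank_def by (metis card.empty not_less_zero)+
  then obtain j k where j: "j \<in> C" "j < p" "v \<le> u j" and k: "k \<in> C" "p \<le> k" "u k < v"
    by blast
  define p0 where "p0 = Max {i \<in> C. i < p}"
  have "p0 \<in> {i \<in> C. i < p}"
    unfolding p0_def using fin j by (intro Max_in) auto
  then have p0: "p0 \<in> C" "p0 < p"
    by auto
  have p0_max: "i \<le> p0" if "i \<in> C" "i < p" for i
    unfolding p0_def using fin that by (intro Max_ge) auto
  define p1 where "p1 = Min {i \<in> C. p \<le> i}"
  have "p1 \<in> {i \<in> C. p \<le> i}"
    unfolding p1_def using fin k by (intro Min_in) auto
  then have p1: "p1 \<in> C" "p \<le> p1"
    by auto
  have p1_min: "p1 \<le> i" if "i \<in> C" "p \<le> i" for i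
    unfolding p1_def using fin that by (intro Min_le) auto
  define v0 where "v0 = Max {x \<in> w ` C. x < v}"
  have uk: "u k \<in> {x \<in> w ` C. x < v}" and uj: "u j \<in> {x \<in> w ` C. v \<le> x}"
    using j k img by blast+
  have "v0 \<in> {x \<in> w ` C. x < v}"
    unfolding v0_def using fin uk by (intro Max_in) auto
  then obtain d where d: "d \<in> C" "w d = v0" "v0 < v"
    by auto
  have v0_max: "x \<le> v0" if "x \<in> w ` C" "x < v" for x
    unfolding v0_def using fin that by (intro Max_ge) auto
  define v1 where "v1 = Min {x \<in> w ` C. v \<le> x}"
  have "v1 \<in> {x \<in> w ` C. v \<le> x}"
    unfolding v1_def using fin uj by (intro Min_in) auto
  then obtain c where c: "c \<in> C" "w c = v1" "v \<le> v1"
    by auto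
  have v1_min: "v1 \<le> x" if "x \<in> w ` C" "v \<le> x" for x
    unfolding v1_def using fin that by (intro Min_le) auto
  \<comment> \<open>In cases 1 to 4 the grid point moves across \<open>p0\<close> or
    \<open>p1\<close>, or across the value at \<open>d\<close> or \<open>c\<close>: one point of
    \<open>w\<close> drops out of one corner and the other corner keeps its count. The rank of
    \<open>u\<close> falls by at most one in cases 1 and 4, where that of \<open>w\<close> falls by
    one, and does not fall in cases 2 and 3. The \<open>Suc\<close> in cases 2 and 4 matches the
    strict test on positions and the weak test on values. In case 5 no move is left.\<close>
  consider "v \<le> w p0" | "w p1 < v" | "p \<le> d" | "c < p"
    | "w p0 < v" "v \<le> w p1" "d < p" "p \<le> c"
    by linarith
  then show ?case
  proof cases
    case 1
    have "{j \<in> C. j < p \<and> v \<le> w j} = insert p0 {j \<in> C. j < p0 \<and> v \<le> w j}"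
      using 1 p0 p0_max by (auto simp: order_less_le)
    then have w: "rank C w p v = Suc (rank C w p0 v)"
      unfolding rank_def using fin by (simp add: card_insert_if)
    have "{j \<in> C. j < p \<and> v \<le> u j} \<subseteq> insert p0 {j \<in> C. j < p0 \<and> v \<le> u j}"
      using p0_max by (auto simp: order_less_le)
    then have "rank C u p v \<le> card (insert p0 {j \<in> C. j < p0 \<and> v \<le> u j})"
      unfolding rank_def using fin by (intro card_mono) auto
    also have "\<dots> = Suc (rank C u p0 v)"
      unfolding rank_def using fin by (simp add: card_insert_if)
    finally have u: "rank C u p v \<le> Suc (rank C u p0 v)" .
    have "{j \<in> C. p0 \<le> j \<and> w j < v} = {j \<in> C. p \<le> j \<and> w j < v}"
      using 1 p0 p0_max by (metis (no_types, lifting) leD le_antisym le_trans less_imp_le not_less)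
    then have "corank C w p0 v = corank C w p v"
      by (simp add: corank_def)
    then show ?thesis
      using w u viol by (intro less.hyps[of p0 v]) linarith+
  next
    case 2
    have "{j \<in> C. p \<le> j \<and> w j < v} = insert p1 {j \<in> C. Suc p1 \<le> j \<and> w j < v}"
      using 2 p1 p1_min by (auto simp: Suc_le_eq order_less_le intro: order_trans)
    then have co: "corank C w p v = Suc (corank C w (Suc p1) v)"
      unfolding corank_def using fin by (simp add: card_insert_if)
    have "{j \<in> C. j < Suc p1 \<and> v \<le> w j} = {j \<in> C. j < p \<and> v \<le> w j}"
      using 2 p1 p1_min by (metis (no_types, lifting) leD le_antisym less_Suc_eq_le less_le_trans not_less order_less_imp_le)
    then have w: "rank C w (Suc p1) v = rank C w p v"
      by (simp add: rank_def)
    have "{j \<in> C. j < p \<and> v \<le> u j} \<subseteq> {j \<in> C. j < Suc p1 \<and> v \<le> u j}"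
      using p1 by auto
    then have "rank C u p v \<le> rank C u (Suc p1) v"
      unfolding rank_def using fin by (intro card_mono) auto
    then show ?thesis
      using w co viol by (intro less.hyps[of "Suc p1" v]) linarith+
  next
    case 3
    have below: "w i < w d" if "i \<in> C" "w i < v" "i \<noteq> d" for i
      using that v0_max[of "w i"] d assms(3) by (metis imageI inj_onD le_neq_implies_less)
    have above: "v \<le> w i" if "i \<in> C" "i < p" "w d \<le> w i" for i
      using that below[of i] 3 by (metis leD le_less_linear)
    have eq: "{j \<in> C. p \<le> j \<and> w j < v} = insert d {j \<in> C. p \<le> j \<and> w j < w d}"
      "{j \<in> C. j < p \<and> w d \<le> w j} = {j \<in> C. j < p \<and> v \<le> w j}"
      using 3 d below above by auto
    have co: "corank C w p v = Suc (corank C w p (w d))"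
      unfolding corank_def eq using fin by (simp add: card_insert_if)
    have w: "rank C w p (w d) = rank C w p v"
      unfolding rank_def eq ..
    have "{j \<in> C. j < p \<and> v \<le> u j} \<subseteq> {j \<in> C. j < p \<and> w d \<le> u j}"
      using d by auto
    then have "rank C u p v \<le> rank C u p (w d)"
      unfolding rank_def using fin by (intro card_mono) auto
    then show ?thesis
      using w co viol by (intro less.hyps[of p "w d"]) linarith+
  next
    case 4
    have above: "Suc (w c) \<le> w i" if "i \<in> C" "v \<le> w i" "i \<noteq> c" for i
      using that v1_min[of "w i"] c assms(3) by (metis Suc_leI imageI inj_onD le_neq_implies_less)
    have below: "w i < v" if "i \<in> C" "p \<le> i" "w i < Suc (w c)" for i
      using that above[of i] 4 by (metis leD le_less_linear)
    have eq: "{j \<in> C. j < p \<and> v \<le> w j} = insert c {j \<in> C. j < p \<and> Suc (w c) \<le> w j}"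
      "{j \<in> C. p \<le> j \<and> w j < Suc (w c)} = {j \<in> C. p \<le> j \<and> w j < v}"
      using 4 c above below by auto
    have w: "rank C w p v = Suc (rank C w p (Suc (w c)))"
      unfolding rank_def eq using fin by (simp add: card_insert_if)
    have co: "corank C w p (Suc (w c)) = corank C w p v"
      unfolding corank_def eq ..
    \<comment> \<open>Since \<open>w c\<close> is the least value from \<open>v\<close> on, raising
      the threshold past it can lose only this point of \<open>u\<close>.\<close>
    obtain e where e: "e \<in> C" "u e = w c"
      using c(1) img by (metis imageE imageI)
    have "{j \<in> C. j < p \<and> v \<le> u j} \<subseteq> insert e {j \<in> C. j < p \<and> Suc (w c) \<le> u j}"
    proof
      fix i assume i: "i \<in> {j \<in> C. j < p \<and> v \<le> u j}"
      then have "w c \<le> u i"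
        using v1_min[of "u i"] c(2) img by blast
      moreover have "i = e" if "u i = w c"
        using inj_onD[OF assms(2), of i e] that e i by simp
      ultimately show "i \<in> insert e {j \<in> C. j < p \<and> Suc (w c) \<le> u j}"
        using i by force
    qed
    then have "rank C u p v \<le> card (insert e {j \<in> C. j < p \<and> Suc (w c) \<le> u j})"
      unfolding rank_def using fin by (intro card_mono) auto
    also have "\<dots> \<le> Suc (rank C u p (Suc (w c)))"
      unfolding rank_def using fin by (simp add: card_insert_if)
    finally show ?thesis
      using w co viol by (intro less.hyps[of p "Suc (w c)"]) linarith+
  next
    case 5
    have "w p0 \<le> w d" "w c \<le> w p1"
      using 5 d c p0 p1 v0_max[of "w p0"] v1_min[of "w p1"] by auto
    moreover have "w c \<le> u j" "u k \<le> w d"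
      using uj uk v1_min[of "u j"] v0_max[of "u k"] c(2) d(2) by auto
    moreover have "d \<le> p0" "p1 \<le> c" "j \<le> p0" "p1 \<le> k"
      using 5 d c j k p0_max p1_min by auto
    moreover have "p0 < p1" "w d < w c"
      using p0 p1 c d by linarith+
    ultimately show ?thesis
      using p0 p1 c d j k
      by - (rule exI[of _ p0], rule exI[of _ p1], rule exI[of _ d], rule exI[of _ c], rule exI[of _ j], rule exI[of _ k], simp)
  qed
qed

text \<open>The corner at the point \<open>(j, u j)\<close> itself contains a point of
  \<open>u\<close>, hence one of \<open>w\<close>; the \<open>Suc\<close> lets the point pass the
  strict test. The second claim is the opposite corner, reached through
  \<open>rank_corank\<close>.\<close>

lemma bruhat_le_hull:
  assumes "bruhat_le n u w" "j \<in> {1..n}"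
  shows "\<exists>a\<in>{1..n}. a \<le> j \<and> u j \<le> w a" "\<exists>b\<in>{1..n}. j \<le> b \<and> w b \<le> u j"
proof -
  let ?C = "{1..n}"
  have u: "u permutes ?C" and w: "w permutes ?C"
    using assms(1) by (auto simp: bruhat_le_def)
  have "{i \<in> ?C. i < Suc j \<and> u j \<le> u i} \<noteq> {}"
    using assms(2) by auto
  then have "0 < rank ?C u (Suc j) (u j)"
    unfolding rank_def by (subst card_gt_0_iff) simp
  then have "0 < rank ?C w (Suc j) (u j)"
    using bruhat_le_rank[OF assms(1)] by (meson less_le_trans)
  then have "{i \<in> ?C. i < Suc j \<and> u j \<le> w i} \<noteq> {}"
    unfolding rank_def by (metis card.empty less_irrefl)
  then show "\<exists>a\<in>{1..n}. a \<le> j \<and> u j \<le> w a"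
    by (auto simp: less_Suc_eq_le)
  have "{i \<in> ?C. j \<le> i \<and> u i < Suc (u j)} \<noteq> {}"
    using assms(2) by auto
  then have "0 < corank ?C u j (Suc (u j))"
    unfolding corank_def by (subst card_gt_0_iff) simp
  moreover have "rank ?C u j (Suc (u j)) \<le> rank ?C w j (Suc (u j))"
    using bruhat_le_rank[OF assms(1)] .
  ultimately have "0 < corank ?C w j (Suc (u j))"
    using rank_corank[of ?C u j "Suc (u j)"] rank_corank[of ?C w j "Suc (u j)"]
      permutes_inj_on[OF u] permutes_inj_on[OF w] permutes_image[OF u] permutes_image[OF w]
    by simp
  then have "{i \<in> ?C. j \<le> i \<and> w i < Suc (u j)} \<noteq> {}"
    unfolding corank_def by (metis card.empty less_irrefl)
  then show "\<exists>b\<in>{1..n}. j \<le> b \<and> w b \<le> u j"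
    by (auto simp: less_Suc_eq_le)
qed

text \<open>The corner points \<open>d\<close>, \<open>p0\<close> (lower left) and \<open>c\<close>,
  \<open>p1\<close> (upper right) come from the violation in \<open>C\<close>, whereas
  \<open>a\<close> and \<open>b\<close> come from the order on all positions. The lower left and the
  upper right alternatives are independent of each other.\<close>

lemma rank_violation_pattern:
  assumes "bruhat_le n u w" "C \<subseteq> {1..n}" "u ` C = w ` C" "rank C w p v < rank C u p v"
  shows "(\<exists>a b c d. 1 \<le> a \<and> a < b \<and> b < c \<and> c < d \<and> d \<le> n \<and>
      w d < w b \<and> w b < w c \<and> w c < w a) \<or>
    (\<exists>a b c d e. 1 \<le> a \<and> a < b \<and> b < c \<and> c < d \<and> d < e \<and> e \<le> n \<and>
      w d < w b \<and> w b < w e \<and> w e < w a \<and> w a < w c) \<or>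
    (\<exists>a b c d e. 1 \<le> a \<and> a < b \<and> b < c \<and> c < d \<and> d < e \<and> e \<le> n \<and>
      w c < w e \<and> w e < w a \<and> w a < w d \<and> w d < w b) \<or>
    (\<exists>a b c d e f. 1 \<le> a \<and> a < b \<and> b < c \<and> c < d \<and> d < e \<and> e < f \<and> f \<le> n \<and>
      w c < w e \<and> w e < w a \<and> w a < w f \<and> w f < w b \<and> w b < w d)"
    (is "?P1 \<or> ?P2 \<or> ?P3 \<or> ?P4")
proof -
  have u: "u permutes {1..n}" and w: "w permutes {1..n}"
    using assms(1) by (auto simp: bruhat_le_def)
  have fin: "finite C"
    using assms(2) by (rule finite_subset) simp
  have inj: "inj_on u C" "inj_on w C"
    using permutes_inj[OF u] permutes_inj[OF w] by (auto intro: inj_on_subset)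
  have winj: "w x \<noteq> w y" if "x \<noteq> y" for x y
    using that permutes_inj[OF w] by (auto dest: injD)
  obtain p0 p1 d c j k where C: "{p0, p1, d, c, j, k} \<subseteq> C"
    and pos1: "p0 < p1" "d \<le> p0" "p1 \<le> c"
    and val1: "w p0 \<le> w d" "w d < w c" "w c \<le> w p1"
    and hull: "j \<le> p0" "w c \<le> u j" "p1 \<le> k" "u k \<le> w d"
    using rank_violation_corner[OF fin inj assms(3,4)] by (elim exE conjE) (rule that)
  note pos = pos1 hull(1,3) and val = val1 hull(2,4)
  have jk: "j \<in> {1..n}" "k \<in> {1..n}"
    using C assms(2) by blast+
  obtain a where a: "a \<in> {1..n}" "a \<le> j" "u j \<le> w a"
    using bruhat_le_hull(1)[OF assms(1) jk(1)] by blast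
  obtain b where b: "b \<in> {1..n}" "k \<le> b" "w b \<le> u k"
    using bruhat_le_hull(2)[OF assms(1) jk(2)] by blast
  have bounds: "1 \<le> a" "b \<le> n" "1 \<le> d" "c \<le> n"
    using a b C assms(2) by auto
  have ne: "a \<noteq> c" "a \<noteq> p0" "a \<noteq> d" "b \<noteq> d" "b \<noteq> p1" "b \<noteq> c"
    using pos val a b by auto
  have a': "a < p0" "w c < w a"
    using pos val a ne winj[OF ne(1)] by auto
  have b': "p1 < b" "w b < w d"
    using pos val b ne winj[OF ne(4)] by auto
  \<comment> \<open>Candidates for a single point between \<open>a\<close> and \<open>b\<close> are
    \<open>c\<close>, which is already below \<open>a\<close>, and \<open>p1\<close>, which is
    already left of \<open>b\<close>. If both fail, \<open>c\<close> lies to the right of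
    \<open>b\<close> and \<open>p1\<close> above \<open>a\<close>, and the two are used together.
    The next statement is the mirror image, with \<open>d\<close> and \<open>p0\<close>.\<close>
  have right: "(\<exists>g. p1 \<le> g \<and> g < b \<and> w c \<le> w g \<and> w g < w a) \<or> (b < c \<and> w a < w p1)"
    using pos val a' b' ne winj[of a p1] by (metis linorder_neqE_nat order_less_le order_refl not_less)
  have left: "(\<exists>g. a < g \<and> g \<le> p0 \<and> w b < w g \<and> w g \<le> w d) \<or> (d < a \<and> w p0 < w b)"
    using pos val a' b' ne winj[of b p0] by (metis linorder_neqE_nat order_less_le order_refl not_less)
  from left show ?thesis
  proof
    assume "\<exists>g. a < g \<and> g \<le> p0 \<and> w b < w g \<and> w g \<le> w d"
    then obtain g where g: "a < g" "g \<le> p0" "w b < w g" "w g \<le> w d"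
      by blast
    from right show ?thesis
    proof
      assume "\<exists>h. p1 \<le> h \<and> h < b \<and> w c \<le> w h \<and> w h < w a"
      then obtain h where h: "p1 \<le> h" "h < b" "w c \<le> w h" "w h < w a"
        by blast
      have ?P1
        using g h bounds pos val
        by - (rule exI[of _ a], rule exI[of _ g], rule exI[of _ h], rule exI[of _ b], linarith)
      then show ?thesis ..
    next
      assume h: "b < c \<and> w a < w p1"
      have ?P2
        using g h bounds pos val a' b'
        by - (rule exI[of _ a], rule exI[of _ g], rule exI[of _ p1], rule exI[of _ b], rule exI[of _ c], linarith)
      then show ?thesis by blast
    qed
  next
    assume g: "d < a \<and> w p0 < w b"
    from right show ?thesis
    proof
      assume "\<exists>h. p1 \<le> h \<and> h < b \<and> w c \<le> w h \<and> w h < w a"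
      then obtain h where h: "p1 \<le> h" "h < b" "w c \<le> w h" "w h < w a"
        by blast
      have ?P3
        using g h bounds pos val a' b'
        by - (rule exI[of _ d], rule exI[of _ a], rule exI[of _ p0], rule exI[of _ h], rule exI[of _ b], linarith)
      then show ?thesis by blast
    next
      assume h: "b < c \<and> w a < w p1"
      have ?P4
        using g h bounds pos val a' b'
        by - (rule exI[of _ d], rule exI[of _ a], rule exI[of _ p0], rule exI[of _ p1], rule exI[of _ b], rule exI[of _ c], linarith)
      then show ?thesis by blast
    qed
  qed
qed

section \<open>Patterns as increasing lists of positions\<close>

text \<open>Since \<open>w\<close> is injective and \<open>xs\<close> distinct, the comparisons for
  \<open>k < l\<close> determine all others; the form symmetric in \<open>k\<close> and
  \<open>l\<close> is the one that reversal respects. Positions count from 1 in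
  \<open>one_line\<close> and from 0 in lists.\<close>

lemma avoids_iff_list:
  assumes "inj w" "distinct xs"
  shows "avoids n w xs \<longleftrightarrow> \<not> (\<exists>ps. length ps = length xs \<and> sorted_wrt (<) ps \<and> set ps \<subseteq> {1..n} \<and>
    (\<forall>k<length xs. \<forall>l<length xs. w (ps ! k) < w (ps ! l) \<longleftrightarrow> xs ! k < xs ! l))"
    (is "_ \<longleftrightarrow> \<not> ?R")
proof -
  let ?m = "length xs"
  have "?R" if pattern: "has_pattern n w ?m (one_line xs)"
  proof -
    obtain i where mono: "strict_mono_on {1..?m} i" and sub: "i ` {1..?m} \<subseteq> {1..n}"
      and pat: "\<forall>k\<in>{1..?m}. \<forall>l\<in>{1..?m}. k < l \<longrightarrow>
        (w (i k) < w (i l) \<longleftrightarrow> one_line xs k < one_line xs l)"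
      using pattern unfolding has_pattern_def by blast
    define ps where "ps = map (\<lambda>k. i (Suc k)) [0..<?m]"
    have nth: "ps ! k = i (Suc k)" if "k < ?m" for k
      using that by (simp add: ps_def)
    have less: "w (ps ! k) < w (ps ! l) \<longleftrightarrow> xs ! k < xs ! l" if "k < l" "l < ?m" for k l
      using that pat[rule_format, of "Suc k" "Suc l"] by (simp add: nth one_line_def)
    have less': "w (ps ! k) < w (ps ! l) \<longleftrightarrow> xs ! k < xs ! l" if "k < ?m" "l < ?m" for k l
    proof (cases k l rule: linorder_cases)
      case greater
      have "i (Suc l) < i (Suc k)"
        using greater that by (intro strict_mono_onD[OF mono]) auto
      then have "w (ps ! k) \<noteq> w (ps ! l)"
        using that assms(1) by (simp add: nth inj_eq)
      moreover have "xs ! k \<noteq> xs ! l"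
        using that greater assms(2) by (simp add: nth_eq_iff_index_eq)
      ultimately show ?thesis
        using less[OF greater that(1)] by auto
    qed (use that less in auto)
    have "sorted_wrt (<) ps"
      unfolding sorted_wrt_iff_nth_less using mono
      by (auto simp: nth ps_def intro!: strict_mono_onD[OF mono])
    moreover have "set ps \<subseteq> {1..n}"
    proof
      fix x assume "x \<in> set ps"
      then obtain k where "k < ?m" "x = i (Suc k)"
        by (auto simp: ps_def)
      then show "x \<in> {1..n}"
        using sub by (force simp: image_subset_iff)
    qed
    moreover have "length ps = ?m"
      by (simp add: ps_def)
    ultimately show ?R
      using less' by blast
  qed
  moreover have "has_pattern n w ?m (one_line xs)" if ?R
  proof -
    obtain ps where ps: "length ps = ?m" "sorted_wrt (<) ps" "set ps \<subseteq> {1..n}"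
      "\<forall>k<?m. \<forall>l<?m. w (ps ! k) < w (ps ! l) \<longleftrightarrow> xs ! k < xs ! l"
      using \<open>?R\<close> by blast
    have "strict_mono_on {1..?m} (one_line ps)"
    proof (rule strict_mono_onI)
      fix r s assume "r \<in> {1..?m}" "s \<in> {1..?m}" "r < s"
      then show "one_line ps r < one_line ps s"
        using ps(1) sorted_wrt_nth_less[OF ps(2), of "r - 1" "s - 1"] by (auto simp: one_line_def)
    qed
    moreover have "one_line ps ` {1..?m} \<subseteq> {1..n}"
    proof
      fix x assume "x \<in> one_line ps ` {1..?m}"
      then obtain k where "k \<in> {1..?m}" "x = ps ! (k - 1)"
        using ps(1) by (auto simp: one_line_def)
      then have "x \<in> set ps"
        using ps(1) by auto
      then show "x \<in> {1..n}"
        using ps(3) by blast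
    qed
    moreover have "w (one_line ps k) < w (one_line ps l) \<longleftrightarrow> one_line xs k < one_line xs l"
      if "k \<in> {1..?m}" "l \<in> {1..?m}" for k l
    proof -
      have "k - 1 < ?m" "l - 1 < ?m"
        using that by auto
      then have "w (ps ! (k - 1)) < w (ps ! (l - 1)) \<longleftrightarrow> xs ! (k - 1) < xs ! (l - 1)"
        using ps(4) by blast
      then show ?thesis
        using that ps(1) by (simp add: one_line_def)
    qed
    ultimately show ?thesis
      unfolding has_pattern_def by blast
  qed
  ultimately show ?thesis
    unfolding avoids_def by blast
qed

lemma avoids_4231:
  assumes "inj w"
  shows "avoids n w [4,2,3,1] \<longleftrightarrow> \<not> (\<exists>a b c d. 1 \<le> a \<and> a < b \<and> b < c \<and> c < d \<and> d \<le> n \<and>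
    w d < w b \<and> w b < w c \<and> w c < w a)"
    (is "_ \<longleftrightarrow> \<not> ?R")
proof -
  let ?xs = "[4,2,3,1] :: nat list"
  have "?R \<longleftrightarrow> (\<exists>ps. length ps = length ?xs \<and> sorted_wrt (<) ps \<and> set ps \<subseteq> {1..n} \<and>
    (\<forall>k<length ?xs. \<forall>l<length ?xs. w (ps ! k) < w (ps ! l) \<longleftrightarrow> ?xs ! k < ?xs ! l))"
    (is "_ \<longleftrightarrow> ?L")
  proof
    assume ?R
    then obtain a b c d where pos: "1 \<le> a" "a < b" "b < c" "c < d" "d \<le> n"
      and val: "w d < w b" "w b < w c" "w c < w a"
      by blast
    let ?ps = "[a, b, c, d]"
    have "sorted_wrt (<) ?ps" "set ?ps \<subseteq> {1..n}"
      using pos by auto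
    moreover have "\<forall>k<length ?xs. \<forall>l<length ?xs. w (?ps ! k) < w (?ps ! l) \<longleftrightarrow> ?xs ! k < ?xs ! l"
      using val by (simp add: All_less_Suc)
    ultimately show ?L
      by (intro exI[of _ ?ps]) simp
  next
    assume ?L
    then obtain ps where ps: "length ps = length ?xs" "sorted_wrt (<) ps" "set ps \<subseteq> {1..n}"
      and pat: "\<And>k l. k < length ?xs \<Longrightarrow> l < length ?xs \<Longrightarrow> w (ps ! k) < w (ps ! l) \<longleftrightarrow> ?xs ! k < ?xs ! l"
      by blast
    obtain a b c d where "ps = [a, b, c, d]"
      using ps(1) by (auto simp: length_Suc_conv)
    \<comment> \<open>The indices 3, 1, 2, 0 carry the entries 1, 2, 3, 4, and the instances of
      \<open>pat\<close> compare consecutive entries. The longer patterns are unfolded in the same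
      way.\<close>
    then show ?R
      using ps(2,3) pat[of 3 1] pat[of 1 2] pat[of 2 0]
      by - (rule exI[of _ a], rule exI[of _ b], rule exI[of _ c], rule exI[of _ d], simp)
  qed
  then show ?thesis
    using avoids_iff_list[OF assms, of ?xs n] by simp
qed

lemma avoids_42513:
  assumes "inj w"
  shows "avoids n w [4,2,5,1,3] \<longleftrightarrow> \<not> (\<exists>a b c d e. 1 \<le> a \<and> a < b \<and> b < c \<and> c < d \<and> d < e \<and> e \<le> n \<and>
    w d < w b \<and> w b < w e \<and> w e < w a \<and> w a < w c)"
    (is "_ \<longleftrightarrow> \<not> ?R")
proof -
  let ?xs = "[4,2,5,1,3] :: nat list"
  have "?R \<longleftrightarrow> (\<exists>ps. length ps = length ?xs \<and> sorted_wrt (<) ps \<and> set ps \<subseteq> {1..n} \<and>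
    (\<forall>k<length ?xs. \<forall>l<length ?xs. w (ps ! k) < w (ps ! l) \<longleftrightarrow> ?xs ! k < ?xs ! l))"
    (is "_ \<longleftrightarrow> ?L")
  proof
    assume ?R
    then obtain a b c d e where pos: "1 \<le> a" "a < b" "b < c" "c < d" "d < e" "e \<le> n"
      and val: "w d < w b" "w b < w e" "w e < w a" "w a < w c"
      by blast
    let ?ps = "[a, b, c, d, e]"
    have "sorted_wrt (<) ?ps" "set ?ps \<subseteq> {1..n}"
      using pos by auto
    moreover have "\<forall>k<length ?xs. \<forall>l<length ?xs. w (?ps ! k) < w (?ps ! l) \<longleftrightarrow> ?xs ! k < ?xs ! l"
      using val by (simp add: All_less_Suc)
    ultimately show ?L
      by (intro exI[of _ ?ps]) simp
  next
    assume ?L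
    then obtain ps where ps: "length ps = length ?xs" "sorted_wrt (<) ps" "set ps \<subseteq> {1..n}"
      and pat: "\<And>k l. k < length ?xs \<Longrightarrow> l < length ?xs \<Longrightarrow> w (ps ! k) < w (ps ! l) \<longleftrightarrow> ?xs ! k < ?xs ! l"
      by blast
    obtain a b c d e where "ps = [a, b, c, d, e]"
      using ps(1) by (auto simp: length_Suc_conv)
    then show ?R
      using ps(2,3) pat[of 3 1] pat[of 1 4] pat[of 4 0] pat[of 0 2]
      by - (rule exI[of _ a], rule exI[of _ b], rule exI[of _ c], rule exI[of _ d], rule exI[of _ e], simp)
  qed
  then show ?thesis
    using avoids_iff_list[OF assms, of ?xs n] by simp
qed

lemma avoids_35142:
  assumes "inj w"
  shows "avoids n w [3,5,1,4,2] \<longleftrightarrow> \<not> (\<exists>a b c d e. 1 \<le> a \<and> a < b \<and> b < c \<and> c < d \<and> d < e \<and> e \<le> n \<and>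
    w c < w e \<and> w e < w a \<and> w a < w d \<and> w d < w b)"
    (is "_ \<longleftrightarrow> \<not> ?R")
proof -
  let ?xs = "[3,5,1,4,2] :: nat list"
  have "?R \<longleftrightarrow> (\<exists>ps. length ps = length ?xs \<and> sorted_wrt (<) ps \<and> set ps \<subseteq> {1..n} \<and>
    (\<forall>k<length ?xs. \<forall>l<length ?xs. w (ps ! k) < w (ps ! l) \<longleftrightarrow> ?xs ! k < ?xs ! l))"
    (is "_ \<longleftrightarrow> ?L")
  proof
    assume ?R
    then obtain a b c d e where pos: "1 \<le> a" "a < b" "b < c" "c < d" "d < e" "e \<le> n"
      and val: "w c < w e" "w e < w a" "w a < w d" "w d < w b"
      by blast
    let ?ps = "[a, b, c, d, e]"
    have "sorted_wrt (<) ?ps" "set ?ps \<subseteq> {1..n}"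
      using pos by auto
    moreover have "\<forall>k<length ?xs. \<forall>l<length ?xs. w (?ps ! k) < w (?ps ! l) \<longleftrightarrow> ?xs ! k < ?xs ! l"
      using val by (simp add: All_less_Suc)
    ultimately show ?L
      by (intro exI[of _ ?ps]) simp
  next
    assume ?L
    then obtain ps where ps: "length ps = length ?xs" "sorted_wrt (<) ps" "set ps \<subseteq> {1..n}"
      and pat: "\<And>k l. k < length ?xs \<Longrightarrow> l < length ?xs \<Longrightarrow> w (ps ! k) < w (ps ! l) \<longleftrightarrow> ?xs ! k < ?xs ! l"
      by blast
    obtain a b c d e where "ps = [a, b, c, d, e]"
      using ps(1) by (auto simp: length_Suc_conv)
    then show ?R
      using ps(2,3) pat[of 2 4] pat[of 4 0] pat[of 0 3] pat[of 3 1]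
      by - (rule exI[of _ a], rule exI[of _ b], rule exI[of _ c], rule exI[of _ d], rule exI[of _ e], simp)
  qed
  then show ?thesis
    using avoids_iff_list[OF assms, of ?xs n] by simp
qed

lemma avoids_351624:
  assumes "inj w"
  shows "avoids n w [3,5,1,6,2,4] \<longleftrightarrow> \<not> (\<exists>a b c d e f. 1 \<le> a \<and> a < b \<and> b < c \<and> c < d \<and> d < e \<and> e < f \<and> f \<le> n \<and>
    w c < w e \<and> w e < w a \<and> w a < w f \<and> w f < w b \<and> w b < w d)"
    (is "_ \<longleftrightarrow> \<not> ?R")
proof -
  let ?xs = "[3,5,1,6,2,4] :: nat list"
  have "?R \<longleftrightarrow> (\<exists>ps. length ps = length ?xs \<and> sorted_wrt (<) ps \<and> set ps \<subseteq> {1..n} \<and>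
    (\<forall>k<length ?xs. \<forall>l<length ?xs. w (ps ! k) < w (ps ! l) \<longleftrightarrow> ?xs ! k < ?xs ! l))"
    (is "_ \<longleftrightarrow> ?L")
  proof
    assume ?R
    then obtain a b c d e f where pos: "1 \<le> a" "a < b" "b < c" "c < d" "d < e" "e < f" "f \<le> n"
      and val: "w c < w e" "w e < w a" "w a < w f" "w f < w b" "w b < w d"
      by blast
    let ?ps = "[a, b, c, d, e, f]"
    have "sorted_wrt (<) ?ps" "set ?ps \<subseteq> {1..n}"
      using pos by auto
    moreover have "\<forall>k<length ?xs. \<forall>l<length ?xs. w (?ps ! k) < w (?ps ! l) \<longleftrightarrow> ?xs ! k < ?xs ! l"
      using val by (simp add: All_less_Suc)
    ultimately show ?L
      by (intro exI[of _ ?ps]) simp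
  next
    assume ?L
    then obtain ps where ps: "length ps = length ?xs" "sorted_wrt (<) ps" "set ps \<subseteq> {1..n}"
      and pat: "\<And>k l. k < length ?xs \<Longrightarrow> l < length ?xs \<Longrightarrow> w (ps ! k) < w (ps ! l) \<longleftrightarrow> ?xs ! k < ?xs ! l"
      by blast
    obtain a b c d e f where "ps = [a, b, c, d, e, f]"
      using ps(1) by (auto simp: length_Suc_conv)
    then show ?R
      using ps(2,3) pat[of 2 4] pat[of 4 0] pat[of 0 5] pat[of 5 1] pat[of 1 3]
      by - (rule exI[of _ a], rule exI[of _ b], rule exI[of _ c], rule exI[of _ d], rule exI[of _ e], rule exI[of _ f], simp)
  qed
  then show ?thesis
    using avoids_iff_list[OF assms, of ?xs n] by simp
qed

section \<open>Bad pairs below a permutation with a pattern\<close>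

text \<open>With the swap as the last factor on the right, a product of transpositions can be peeled
  off one factor at a time.\<close>

lemma bruhat_le_swap_down:
  assumes "bruhat_le n v w" "1 \<le> p" "p < q" "q \<le> n" "v q < v p"
  shows "bruhat_le n (v \<circ> Transposition.transpose p q) w"
proof -
  have v: "v permutes {1..n}"
    using assms(1) by (simp add: bruhat_le_def)
  have "bruhat_le n (v \<circ> Transposition.transpose p q)
      (v \<circ> Transposition.transpose p q \<circ> Transposition.transpose p q)"
    using assms by (intro bruhat_le_swap swap_permutes v) auto
  then show ?thesis
    using bruhat_le_trans[OF _ assms(1)] by (simp add: comp_assoc)
qed

lemma bruhat_le_refl: "w permutes {1..n} \<Longrightarrow> bruhat_le n w w"
  by (simp add: bruhat_le_def)

text \<open>In a good pair, a corner that is empty for \<open>w\<close> on \<open>C\<close> is empty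
  for \<open>u\<close> as well; the point at \<open>j\<close> contradicts this.\<close>

lemma not_good_pair:
  assumes "C \<subseteq> {1..n}" "u ` C = w ` C" "j \<in> C" "j < p" "y \<le> u j"
    and "\<And>k. k \<in> C \<Longrightarrow> k < p \<Longrightarrow> w k < y"
  shows "\<not> good_pair n u w"
proof
  assume "good_pair n u w"
  then have "rank C u p y \<le> rank C w p y"
    using assms(1,2) by (rule good_pair_rank)
  moreover have "{k \<in> C. k < p \<and> y \<le> w k} = {}"
    using assms(6) by (auto simp: not_le)
  ultimately have "card {k \<in> C. k < p \<and> y \<le> u k} = 0"
    unfolding rank_def by simp
  moreover have "finite C"
    using assms(1) by (rule finite_subset) simp
  ultimately show False
    using assms(3-5) by auto
qed

text \<open>
  The witnesses for the four patterns are those of least length difference, found by computer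
  search; the pair fails on the block of positions named in the last step of each proof.
\<close>

lemma bad_pair_4231:
  assumes "w permutes {1..n}" "1 \<le> a" "a < b" "b < c" "c < d" "d \<le> n"
    "w d < w b" "w b < w c" "w c < w a"
  shows "\<exists>u. bruhat_le n u w \<and> \<not> good_pair n u w"
proof -
  let ?t = Transposition.transpose
  \<comment> \<open>The swaps turn 4231 into 1324: on \<open>b\<close>, \<open>c\<close> the map
    \<open>w\<close> increases and \<open>?u\<close> decreases.\<close>
  let ?u = "w \<circ> ?t a b \<circ> ?t a d \<circ> ?t b c \<circ> ?t c d"
  have "bruhat_le n ?u w"
    using assms(2-)
    by (intro bruhat_le_swap_down bruhat_le_refl[OF assms(1)]) (simp_all add: transpose_def)
  moreover have val: "?u b = w c" "?u c = w b"
    using assms(2-) by (simp_all add: transpose_def)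
  have "\<not> good_pair n ?u w"
  proof (rule not_good_pair[where C = "{b, c}" and p = c and j = b and y = "w c"])
    show "?u ` {b, c} = w ` {b, c}"
      using val by (simp add: insert_commute del: comp_apply)
  qed (use assms val in auto)
  ultimately show ?thesis
    by blast
qed

lemma bad_pair_42513:
  assumes "w permutes {1..n}" "1 \<le> a" "a < b" "b < c" "c < d" "d < e" "e \<le> n"
    "w d < w b" "w b < w e" "w e < w a" "w a < w c"
  shows "\<exists>u. bruhat_le n u w \<and> \<not> good_pair n u w"
proof -
  let ?t = Transposition.transpose
  \<comment> \<open>The swaps turn 42513 into 13245. On the block \<open>b\<close>,
    \<open>c\<close>, \<open>e\<close> this reads 325 against 253 for \<open>w\<close>, and the
    first entries violate domination.\<close>
  let ?u = "w \<circ> ?t a b \<circ> ?t a d \<circ> ?t b e \<circ> ?t c d \<circ> ?t d e"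
  have "bruhat_le n ?u w"
    using assms(2-)
    by (intro bruhat_le_swap_down bruhat_le_refl[OF assms(1)]) (simp_all add: transpose_def)
  moreover have val: "?u b = w e" "?u c = w b" "?u e = w c"
    using assms(2-) by (simp_all add: transpose_def)
  have "\<not> good_pair n ?u w"
  proof (rule not_good_pair[where C = "{b, c, e}" and p = c and j = b and y = "w e"])
    show "?u ` {b, c, e} = w ` {b, c, e}"
      using val by (simp add: insert_commute del: comp_apply)
  qed (use assms val in auto)
  ultimately show ?thesis
    by blast
qed

lemma bad_pair_35142:
  assumes "w permutes {1..n}" "1 \<le> a" "a < b" "b < c" "c < d" "d < e" "e \<le> n"
    "w c < w e" "w e < w a" "w a < w d" "w d < w b"
  shows "\<exists>u. bruhat_le n u w \<and> \<not> good_pair n u w"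
proof -
  let ?t = Transposition.transpose
  \<comment> \<open>The swaps turn 35142 into 12435. On the block \<open>a\<close>,
    \<open>c\<close>, \<open>d\<close> this reads 143 against 314 for \<open>w\<close>: the entry 4
    comes too early.\<close>
  let ?u = "w \<circ> ?t a c \<circ> ?t b c \<circ> ?t b e \<circ> ?t c d \<circ> ?t d e"
  have "bruhat_le n ?u w"
    using assms(2-)
    by (intro bruhat_le_swap_down bruhat_le_refl[OF assms(1)]) (simp_all add: transpose_def)
  moreover have val: "?u a = w c" "?u c = w d" "?u d = w a"
    using assms(2-) by (simp_all add: transpose_def)
  have "\<not> good_pair n ?u w"
  proof (rule not_good_pair[where C = "{a, c, d}" and p = d and j = c and y = "w d"])
    show "?u ` {a, c, d} = w ` {a, c, d}"
      using val by (simp add: insert_commute del: comp_apply)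
  qed (use assms val in auto)
  ultimately show ?thesis
    by blast
qed

lemma bad_pair_351624:
  assumes "w permutes {1..n}" "1 \<le> a" "a < b" "b < c" "c < d" "d < e" "e < f" "f \<le> n"
    "w c < w e" "w e < w a" "w a < w f" "w f < w b" "w b < w d"
  shows "\<exists>u. bruhat_le n u w \<and> \<not> good_pair n u w"
proof -
  let ?t = Transposition.transpose
  \<comment> \<open>The swaps turn 351624 into 124356. On the block \<open>a\<close>,
    \<open>c\<close>, \<open>d\<close>, \<open>f\<close> this reads 1436 against 3164 for
    \<open>w\<close>: among the first two entries only \<open>?u\<close> reaches 4.\<close>
  let ?u = "w \<circ> ?t a c \<circ> ?t b c \<circ> ?t b e \<circ> ?t c f \<circ> ?t d e \<circ> ?t e f"
  have "bruhat_le n ?u w"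
    using assms(2-)
    by (intro bruhat_le_swap_down bruhat_le_refl[OF assms(1)]) (simp_all add: transpose_def)
  moreover have val: "?u a = w c" "?u c = w f" "?u d = w a" "?u f = w d"
    using assms(2-) by (simp_all add: transpose_def)
  have "\<not> good_pair n ?u w"
  proof (rule not_good_pair[where C = "{a, c, d, f}" and p = d and j = c and y = "w f"])
    show "?u ` {a, c, d, f} = w ` {a, c, d, f}"
      using val by (simp add: insert_commute del: comp_apply)
  qed (use assms val in auto)
  ultimately show ?thesis
    by blast
qed

lemma good_pairs_below_iff_avoids:
  assumes w: "w permutes {1..n}"
  shows "(\<forall>w'. w' permutes {1..n} \<longrightarrow> bruhat_le n w' w \<longrightarrow> good_pair n w' w) \<longleftrightarrow>
    avoids n w [4,2,3,1] \<and> avoids n w [4,2,5,1,3] \<and>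
    avoids n w [3,5,1,4,2] \<and> avoids n w [3,5,1,6,2,4]"
    (is "?good \<longleftrightarrow> ?avoids")
proof
  assume ?good
  then have no_bad: "\<not> (\<exists>u. bruhat_le n u w \<and> \<not> good_pair n u w)"
    by (auto simp: bruhat_le_def)
  note avoids_patterns = avoids_4231 avoids_42513 avoids_35142 avoids_351624
  show ?avoids
    unfolding avoids_patterns[OF permutes_inj[OF w]]
    using no_bad bad_pair_4231[OF w] bad_pair_42513[OF w] bad_pair_35142[OF w] bad_pair_351624[OF w]
    by (intro conjI notI; elim exE conjE) metis+
next
  assume avoids: ?avoids
  show ?good
  proof (intro allI impI)
    fix u assume u: "bruhat_le n u w"
    show "good_pair n u w"
    proof (rule good_pair_of_rank_le[OF u], rule ccontr)
      fix C p v assume C: "C \<subseteq> {1..n}" "u ` C = w ` C" and "\<not> rank C u p v \<le> rank C w p v"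
      then have "rank C w p v < rank C u p v"
        by simp
      from rank_violation_pattern[OF u C this] avoids show False
        unfolding avoids_4231[OF permutes_inj[OF w]] avoids_42513[OF permutes_inj[OF w]]
          avoids_35142[OF permutes_inj[OF w]] avoids_351624[OF permutes_inj[OF w]]
        by (elim disjE conjE) (erule (1) notE)+
    qed
  qed
qed

section \<open>Reversal of positions\<close>

text \<open>The longest element of the group, extended by the identity so that it permutes
  \<open>{1..n}\<close>.\<close>

definition reversal :: "nat \<Rightarrow> nat \<Rightarrow> nat" where
  "reversal n k = (if k \<in> {1..n} then n + 1 - k else k)"

lemma reversal_reversal [simp]: "reversal n (reversal n k) = k"
  by (auto simp: reversal_def)

lemma reversal_comp [simp]: "w \<circ> reversal n \<circ> reversal n = w"
  by (simp add: fun_eq_iff)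

lemma reversal_in_iff [simp]: "reversal n k \<in> {1..n} \<longleftrightarrow> k \<in> {1..n}"
  by (auto simp: reversal_def)

lemma reversal_less:
  assumes "1 \<le> p" "p < q" "q \<le> n"
  shows "reversal n q < reversal n p"
  using assms by (auto simp: reversal_def)

lemma reversal_permutes: "reversal n permutes {1..n}"
proof (rule bij_imp_permutes)
  show "bij_betw (reversal n) {1..n} {1..n}"
    by (rule bij_betw_byWitness[where f' = "reversal n"])
      (auto simp: reversal_def)
qed (simp add: reversal_def del: atLeastAtMost_iff)

lemma comp_reversal_permutes: "w permutes {1..n} \<Longrightarrow> w \<circ> reversal n permutes {1..n}"
  by (rule permutes_compose[OF reversal_permutes])

text \<open>Mirroring the positions of an occurrence reverses their order, so the list of positions
  and the pattern are both read backwards.\<close>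

lemma not_avoids_reversal:
  assumes "inj w" "distinct xs" "\<not> avoids n (w \<circ> reversal n) xs"
  shows "\<not> avoids n w (rev xs)"
proof -
  have "inj (w \<circ> reversal n)"
    using assms(1) permutes_inj[OF reversal_permutes] by (rule inj_compose)
  then obtain ps where ps: "length ps = length xs" "sorted_wrt (<) ps" "set ps \<subseteq> {1..n}"
    "\<forall>k<length xs. \<forall>l<length xs. (w \<circ> reversal n) (ps ! k) < (w \<circ> reversal n) (ps ! l) \<longleftrightarrow> xs ! k < xs ! l"
    using assms(2,3) avoids_iff_list by blast
  let ?ps = "rev (map (reversal n) ps)"
  have "length ?ps = length (rev xs)"
    using ps(1) by simp
  moreover have "sorted_wrt (\<lambda>x y. reversal n y < reversal n x) ps"
  proof (rule sorted_wrt_mono_rel[OF _ ps(2)])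
    fix x y assume "x \<in> set ps" "y \<in> set ps" "x < y"
    then have "x \<in> {1..n}" "y \<in> {1..n}" "x < y"
      using ps(3) by blast+
    then show "reversal n y < reversal n x"
      using reversal_less by simp
  qed
  then have "sorted_wrt (<) ?ps"
    by (simp add: sorted_wrt_rev sorted_wrt_map)
  moreover have "set ?ps \<subseteq> {1..n}"
    using ps(3) reversal_in_iff unfolding set_rev set_map by blast
  moreover have "w (?ps ! k) < w (?ps ! l) \<longleftrightarrow> rev xs ! k < rev xs ! l"
    if "k < length (rev xs)" "l < length (rev xs)" for k l
    using that ps(1) ps(4)[rule_format, of "length xs - Suc k" "length xs - Suc l"]
    by (simp add: rev_nth)
  ultimately have "\<exists>ps. length ps = length (rev xs) \<and> sorted_wrt (<) ps \<and> set ps \<subseteq> {1..n} \<and>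
    (\<forall>k<length (rev xs). \<forall>l<length (rev xs). w (ps ! k) < w (ps ! l) \<longleftrightarrow> rev xs ! k < rev xs ! l)"
    by blast
  then show ?thesis
    using avoids_iff_list[OF assms(1), of "rev xs" n] assms(2) unfolding distinct_rev by blast
qed

text \<open>Reversal of positions and \<open>rev\<close> are involutions, so the converse is the
  same implication applied to \<open>w \<circ> reversal n\<close> and \<open>rev xs\<close>.\<close>

lemma avoids_reversal:
  assumes "inj w" "distinct xs"
  shows "avoids n (w \<circ> reversal n) xs \<longleftrightarrow> avoids n w (rev xs)"
proof -
  have "inj (w \<circ> reversal n)"
    using assms(1) permutes_inj[OF reversal_permutes] by (rule inj_compose)
  from not_avoids_reversal[OF this, of "rev xs" n] not_avoids_reversal[OF assms, of n] assms(2)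
  show ?thesis
    by (auto simp del: comp_apply)
qed

text \<open>Reflections multiply on the left and the reversal on the right, so the root stays the
  same; only the comparison of lengths is turned around.\<close>

lemma rise_reversal:
  assumes "rise n R u v" "R \<subseteq> roots n" "u permutes {1..n}"
  shows "rise n R (v \<circ> reversal n) (u \<circ> reversal n)"
proof -
  obtain p q where pq: "1 \<le> p" "p < q" "q \<le> n" "u p < u q" "v = u \<circ> Transposition.transpose p q"
    using riseE[OF assms] by metis
  obtain \<alpha> where \<alpha>: "\<alpha> \<in> R" "v = reflection \<alpha> \<circ> u"
    using assms(1) by (auto simp: rise_def)
  have "reflection \<alpha> \<circ> v = u"
    unfolding \<alpha>(2) reflection_def by (simp add: comp_assoc[symmetric])
  then have uv: "u \<circ> reversal n = reflection \<alpha> \<circ> (v \<circ> reversal n)"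
    by (simp add: comp_assoc[symmetric])
  have v: "v permutes {1..n}"
    using rise_permutes[OF assms] .
  let ?p = "reversal n q" and ?q = "reversal n p"
  have "?p \<in> {1..n}" "?q \<in> {1..n}"
    using pq by (simp_all only: reversal_in_iff) simp_all
  then have bounds: "1 \<le> ?p" "?p < ?q" "?q \<le> n"
    using reversal_less[OF pq(1-3)] by simp_all
  have "(v \<circ> reversal n) ?p < (v \<circ> reversal n) ?q"
    using pq by simp
  then have "card (inversions n (v \<circ> reversal n))
      < card (inversions n (v \<circ> reversal n \<circ> Transposition.transpose ?p ?q))"
    by (rule card_inversions_swap[OF bounds])
  also have "v \<circ> reversal n \<circ> Transposition.transpose ?p ?q = u \<circ> reversal n"
  proof
    fix k
    have "reversal n k = p \<longleftrightarrow> k = ?q" "reversal n k = q \<longleftrightarrow> k = ?p"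
      by (metis reversal_reversal)+
    then show "(v \<circ> reversal n \<circ> Transposition.transpose ?p ?q) k = (u \<circ> reversal n) k"
      unfolding pq(5) by (auto simp: transpose_def)
  qed
  finally have "coxeter_length n (v \<circ> reversal n) < coxeter_length n (u \<circ> reversal n)"
    using comp_reversal_permutes[OF v] comp_reversal_permutes[OF assms(3)]
    by (simp only: coxeter_length_eq_card_inversions)
  then show ?thesis
    using uv \<alpha>(1) unfolding rise_def by blast
qed

lemma rises_reversal:
  assumes "(rise n R)\<^sup>*\<^sup>* u v" "R \<subseteq> roots n" "u permutes {1..n}"
  shows "(rise n R)\<^sup>*\<^sup>* (v \<circ> reversal n) (u \<circ> reversal n)"
  using assms(1)
proof (induction rule: rtranclp_induct)
  case (step x y)
  have "rise n R (y \<circ> reversal n) (x \<circ> reversal n)"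
    using step.hyps(2) assms(2) rises_permutes[OF step.hyps(1) assms(2,3)] by (rule rise_reversal)
  then show ?case
    using step.IH by (rule converse_rtranclp_into_rtranclp)
qed simp

lemma bruhat_le_reversal:
  assumes "bruhat_le n u w"
  shows "bruhat_le n (w \<circ> reversal n) (u \<circ> reversal n)"
  using assms rises_reversal[of n "roots n" u w] comp_reversal_permutes
  unfolding bruhat_le_def bruhat_step_eq_rise by blast

text \<open>With x = - g^-1 v one has g^-1 v - v = g x - x.\<close>

lemma root_subset_inv_subset:
  assumes "g permutes {1..n}"
  shows "root_subset n (inv g) \<subseteq> root_subset n g"
proof
  fix \<alpha> assume "\<alpha> \<in> root_subset n (inv g)"
  then obtain v where v: "\<alpha> \<in> roots n" "v \<in> rat_space n" "\<alpha> = perm_action (inv g) v - v"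
    by (auto simp: root_subset_def)
  have "\<alpha> = perm_action g (\<lambda>k. - v (g k)) - (\<lambda>k. - v (g k))"
    unfolding v(3) perm_action_def inv_inv_eq[OF permutes_bij[OF assms]]
    by (simp add: fun_eq_iff permutes_inverses[OF assms])
  moreover have "(\<lambda>k. - v (g k)) \<in> rat_space n"
    using v(2) permutes_not_in[OF assms] by (auto simp: rat_space_def)
  ultimately show "\<alpha> \<in> root_subset n g"
    using v(1) by (auto simp: root_subset_def)
qed

lemma root_subset_inv:
  assumes "g permutes {1..n}"
  shows "root_subset n (inv g) = root_subset n g"
  using root_subset_inv_subset[OF assms] root_subset_inv_subset[OF permutes_inv[OF assms]]
  by (simp add: inv_inv_eq[OF permutes_bij[OF assms]])

text \<open>The reversal cancels in the quotient of the new pair, which becomes the inverse of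
  \<open>u \<circ> inv w\<close>. So the admissible roots are the same and the chain is run
  backwards.\<close>

lemma good_pair_reversal:
  assumes "good_pair n u w"
  shows "good_pair n (w \<circ> reversal n) (u \<circ> reversal n)"
proof -
  have le: "bruhat_le n u w"
    using assms by (simp add: good_pair_def)
  then have u: "u permutes {1..n}" and w: "w permutes {1..n}"
    by (simp_all add: bruhat_le_def)
  note bij = permutes_bij[OF u] permutes_bij[OF w] permutes_bij[OF reversal_permutes[of n]]
  have "(w \<circ> reversal n) \<circ> inv (u \<circ> reversal n) = w \<circ> (reversal n \<circ> inv (reversal n)) \<circ> inv u"
    using bij by (simp add: o_inv_distrib comp_assoc)
  also have "\<dots> = inv (u \<circ> inv w)"
    using bij permutes_inv_o(1)[OF reversal_permutes[of n]]
    by (simp add: o_inv_distrib bij_imp_bij_inv inv_inv_eq)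
  finally have "root_subset n ((w \<circ> reversal n) \<circ> inv (u \<circ> reversal n)) = root_subset n (u \<circ> inv w)"
    using root_subset_inv[OF permutes_compose[OF permutes_inv[OF w] u]] by simp
  moreover have "(rise n (root_subset n (u \<circ> inv w)))\<^sup>*\<^sup>* u w"
    using assms good_pair_iff_rises[OF u] by blast
  then have "(rise n (root_subset n (u \<circ> inv w)))\<^sup>*\<^sup>* (w \<circ> reversal n) (u \<circ> reversal n)"
    using root_subset_subset_roots u by (rule rises_reversal)
  ultimately show ?thesis
    using good_pair_iff_rises[OF comp_reversal_permutes[OF w]] bruhat_le_reversal[OF le] by simp
qed

lemma good_pairs_above_iff_below:
  assumes "w permutes {1..n}"
  shows "(\<forall>w''. w'' permutes {1..n} \<longrightarrow> bruhat_le n w w'' \<longrightarrow> good_pair n w w'') \<longleftrightarrow>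
    (\<forall>w'. w' permutes {1..n} \<longrightarrow> bruhat_le n w' (w \<circ> reversal n) \<longrightarrow> good_pair n w' (w \<circ> reversal n))"
  using bruhat_le_reversal good_pair_reversal comp_reversal_permutes reversal_comp by metis

theorem theorem1p4:
  fixes n :: nat and w :: "nat \<Rightarrow> nat"
  assumes "n > 1" and "w permutes {1..n}"
  shows "((\<forall>w'. w' permutes {1..n} \<longrightarrow> bruhat_le n w' w \<longrightarrow> good_pair n w' w) \<longleftrightarrow>
            avoids n w [4,2,3,1] \<and> avoids n w [4,2,5,1,3] \<and>
            avoids n w [3,5,1,4,2] \<and> avoids n w [3,5,1,6,2,4]) \<and>
         ((\<forall>w''. w'' permutes {1..n} \<longrightarrow> bruhat_le n w w'' \<longrightarrow> good_pair n w w'') \<longleftrightarrow>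
            avoids n w [1,3,2,4] \<and> avoids n w [2,4,1,5,3] \<and>
            avoids n w [3,1,5,2,4] \<and> avoids n w [4,2,6,1,5,3])"
proof
  show "(\<forall>w'. w' permutes {1..n} \<longrightarrow> bruhat_le n w' w \<longrightarrow> good_pair n w' w) \<longleftrightarrow>
      avoids n w [4,2,3,1] \<and> avoids n w [4,2,5,1,3] \<and>
      avoids n w [3,5,1,4,2] \<and> avoids n w [3,5,1,6,2,4]"
    using assms(2) by (rule good_pairs_below_iff_avoids)
  \<comment> \<open>Each pattern is read backwards; the second and third exchange places in the list
    of the statement.\<close>
  have "avoids n (w \<circ> reversal n) [4,2,3,1] \<longleftrightarrow> avoids n w [1,3,2,4]"
    "avoids n (w \<circ> reversal n) [4,2,5,1,3] \<longleftrightarrow> avoids n w [3,1,5,2,4]"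
    "avoids n (w \<circ> reversal n) [3,5,1,4,2] \<longleftrightarrow> avoids n w [2,4,1,5,3]"
    "avoids n (w \<circ> reversal n) [3,5,1,6,2,4] \<longleftrightarrow> avoids n w [4,2,6,1,5,3]"
    using permutes_inj[OF assms(2)] by (simp_all add: avoids_reversal)
  then show "(\<forall>w''. w'' permutes {1..n} \<longrightarrow> bruhat_le n w w'' \<longrightarrow> good_pair n w w'') \<longleftrightarrow>
      avoids n w [1,3,2,4] \<and> avoids n w [2,4,1,5,3] \<and>
      avoids n w [3,1,5,2,4] \<and> avoids n w [4,2,6,1,5,3]"
    unfolding good_pairs_above_iff_below[OF assms(2)]
      good_pairs_below_iff_avoids[OF comp_reversal_permutes[OF assms(2)]]
    by blast
qed

end
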